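(* As a left module over itself, $\overline{U}_q(sl_2)$ is the internal direct sum of left ideals $$\overline{U}_q(sl_2)=\bigoplus_{s=1}^{p-1}\bigoplus_{t=1}^{s}\big(\mathcal{P}_s^{+}(t)\oplus\mathcal{P}_s^{-}(t)\big)\oplus\bigoplus_{t=1}^{p}\big(\mathcal{X}_p^{+}(t)\oplus\mathcal{X}_p^{-}(t)\big).$$
   Context: Let $p\ge 2$ be an integer and $q=\exp(\pi\sqrt{-1}/p)$. $\overline{U}_q(sl_2)$ is the associative unital $\mathbb{C}$-algebra generated by $E,F,K,K^{-1}$ with relations $KK^{-1}=K^{-1}K=1$, $KEK^{-1}=q^2E$, $KFK^{-1}=q^{-2}F$, $EF-FE=\frac{K-K^{-1}}{q-q^{-1}}$, $E^p=F^p=0$, $K^{2p}=1$. Write $[n]=\frac{q^n-q^{-n}}{q-q^{-1}}$. Empty products are $1$. A sign $\alpha\in\{+,-\}$ is identified with $\pm1$. For $1\le s,t\le p$ put $v^\alpha(s,t)=\sum_{\ell=0}^{2p-1}(\alpha q^{-(s-2t+1)})^\ell K^\ell$ and $a_n^\alpha(s,t)=F^nE^{p-1}F^{p-t}v^\alpha(s,t)$. For $1\le s\le p-1$, $1\le t\le s$, $0\le n\le s-1$, $0\le k\le p-s-1$ put $\mu_m^\alpha(s)=\prod_{j=p-s-(m-1)}^{p-s-1}(-\alpha[j][p-s-j])$, $b_n^\alpha(s,t)=F^n\sum_{m=1}^{p-s}\mu_m^\alpha(s)E^{p-m-1}F^{p-t-m}v^\alpha(s,t)$, $y_k^\alpha(s,t)=F^{s+k}b_0^\alpha(s,t)$,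 $x_k^\alpha(s,t)=\frac{E^{p-s-k-1}}{\prod_{i=k+1}^{p-s-1}(-\alpha[i][p-s-i])}\sum_{m=1}^{p-s}\mu_m^\alpha(s)E^{p-m}F^{p-t-m}v^\alpha(s,t)$. $\mathcal{X}_p^\alpha(t)$ ($1\le t\le p$) is the span of $a_n^\alpha(p,t)$, $0\le n\le p-1$. $\mathcal{P}_s^\alpha(t)$ ($1\le s\le p-1$, $1\le t\le s$) is the span of $b_n^\alpha(s,t),a_n^\alpha(s,t)$ ($0\le n\le s-1$) and $x_k^\alpha(s,t),y_k^\alpha(s,t)$ ($0\le k\le p-s-1$). All these subspaces are left ideals. *)

theory Defs
  imports
    Complex_Main
    "HOL-Library.Poly_Mapping"
    "HOL-Library.FuncSet"
    "HOL-Library.Numeral_Type"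
begin

section \<open>Free associative algebras over the complex numbers\<close>

text \<open>Words get their own type because lists are not an instance of \<^class>\<open>monoid_add\<close>,
  which \<^type>\<open>poly_mapping\<close> needs for its convolution product. The free unital algebra on
  a set of generators is then the type of finitely supported functions from words to
  complex numbers.\<close>

datatype 'g free_word = Word "'g list"

instantiation free_word :: (type) monoid_add
begin

definition zero_free_word :: "'a free_word" where
  "0 = Word []"

fun plus_free_word :: "'a free_word \<Rightarrow> 'a free_word \<Rightarrow> 'a free_word" where
  "Word u + Word v = Word (u @ v)"

instance
proof
  fix a b c :: "'a free_word"
  show "a + b + c = a + (b + c)" by (cases a; cases b; cases c) simp
  show "0 + a = a" by (cases a) (simp add: zero_free_word_def)
  show "a + 0 = a" by (cases a) (simp add: zero_free_word_def)
qed

end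

type_synonym 'g free_alg = "'g free_word \<Rightarrow>\<^sub>0 complex"

definition free_gen :: "'g \<Rightarrow> 'g free_alg" where
  "free_gen g = Poly_Mapping.single (Word [g]) 1"

definition free_scalar :: "complex \<Rightarrow> 'g free_alg" where
  "free_scalar c = Poly_Mapping.single 0 c"

lemma free_scalar_add: "free_scalar (a + b) = free_scalar a + free_scalar b"
  by (simp add: free_scalar_def single_add)

lemma free_scalar_mult: "free_scalar (a * b) = free_scalar a * free_scalar b"
  by (simp add: free_scalar_def mult_single)

lemma free_scalar_1: "free_scalar 1 = 1"
  by (simp add: free_scalar_def)

lemma free_alg_induct [case_names single add]:
  fixes f :: "'g free_alg"
  assumes single: "\<And>w c. P (Poly_Mapping.single w c)"
    and add: "\<And>f g. P f \<Longrightarrow> P g \<Longrightarrow> P (f + g)"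
  shows "P f"
proof (induction f rule: update_induct)
  case const
  have "P (Poly_Mapping.single 0 0)" by (rule single)
  then show ?case by simp
next
  case (update f a b)
  have "Poly_Mapping.update a b f = Poly_Mapping.single a b + f"
    using update(1)
    by (intro poly_mapping_eqI)
       (auto simp: lookup_update lookup_add lookup_single when_def in_keys_iff)
  then show ?case using add[OF single update(3)] by simp
qed

lemma free_scalar_commute: "free_scalar c * f = f * free_scalar c"
  by (induction f rule: free_alg_induct)
     (simp_all add: free_scalar_def mult_single distrib_left distrib_right mult.commute)

inductive_set two_sided_ideal_gen :: "'a::ring_1 set \<Rightarrow> 'a set" for R where
  base: "r \<in> R \<Longrightarrow> r \<in> two_sided_ideal_gen R"
| zero: "0 \<in> two_sided_ideal_gen R"
| add: "x \<in> two_sided_ideal_gen R \<Longrightarrow> y \<in> two_sided_ideal_gen R \<Longrightarrow> x + y \<in> two_sided_ideal_gen R"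
| left: "x \<in> two_sided_ideal_gen R \<Longrightarrow> a * x \<in> two_sided_ideal_gen R"
| right: "x \<in> two_sided_ideal_gen R \<Longrightarrow> x * a \<in> two_sided_ideal_gen R"

lemma two_sided_ideal_gen_uminus:
  "x \<in> two_sided_ideal_gen R \<Longrightarrow> - x \<in> two_sided_ideal_gen R"
  using two_sided_ideal_gen.left[of x R "- 1"] by simp

lemma two_sided_ideal_gen_diff:
  "x \<in> two_sided_ideal_gen R \<Longrightarrow> y \<in> two_sided_ideal_gen R \<Longrightarrow> x - y \<in> two_sided_ideal_gen R"
  using two_sided_ideal_gen.add[OF _ two_sided_ideal_gen_uminus, of x R y] by simp


section \<open>The restricted quantum group\<close>

definition qroot :: "nat \<Rightarrow> complex" where
  "qroot p = exp (of_real pi * \<i> / of_nat p)"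

definition qint :: "nat \<Rightarrow> nat \<Rightarrow> complex" where
  "qint p n = (qroot p ^ n - inverse (qroot p) ^ n) / (qroot p - inverse (qroot p))"

datatype generator = GenE | GenF | GenK | GenKinv

definition uq_relators :: "nat \<Rightarrow> generator free_alg set" where
  "uq_relators p =
    (let E = free_gen GenE; F = free_gen GenF; K = free_gen GenK; Kinv = free_gen GenKinv;
         q = qroot p
     in {K * Kinv - 1,
         Kinv * K - 1,
         K * E * Kinv - free_scalar (q ^ 2) * E,
         K * F * Kinv - free_scalar (inverse q ^ 2) * F,
         E * F - F * E - free_scalar (1 / (q - inverse q)) * (K - Kinv),
         E ^ p,
         F ^ p,
         K ^ (2 * p) - 1})"

definition uq_ideal :: "nat \<Rightarrow> generator free_alg set" where
  "uq_ideal p = two_sided_ideal_gen (uq_relators p)"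

definition uq_rel :: "'p itself \<Rightarrow> generator free_alg \<Rightarrow> generator free_alg \<Rightarrow> bool" where
  "uq_rel _ x y \<longleftrightarrow> x - y \<in> uq_ideal CARD('p)"

lemma equivp_uq_rel: "equivp (uq_rel TYPE('p))"
proof (rule equivpI)
  show "reflp (uq_rel TYPE('p))"
    by (auto simp: reflp_def uq_rel_def uq_ideal_def two_sided_ideal_gen.zero)
  show "symp (uq_rel TYPE('p))"
  proof (rule sympI)
    fix x y assume "uq_rel TYPE('p) x y"
    then have "- (x - y) \<in> uq_ideal CARD('p)"
      unfolding uq_rel_def uq_ideal_def by (rule two_sided_ideal_gen_uminus)
    then show "uq_rel TYPE('p) y x" by (simp add: uq_rel_def)
  qed
  show "transp (uq_rel TYPE('p))"
  proof (rule transpI)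
    fix x y z assume "uq_rel TYPE('p) x y" "uq_rel TYPE('p) y z"
    then have "(x - y) + (y - z) \<in> uq_ideal CARD('p)"
      unfolding uq_rel_def uq_ideal_def by (rule two_sided_ideal_gen.add)
    then show "uq_rel TYPE('p) x z" by (simp add: uq_rel_def)
  qed
qed

text \<open>The parameter \<open>p\<close> is the cardinality of the index type \<open>'p\<close>, so that the algebra is a type.\<close>

quotient_type 'p uqsl2 = "generator free_alg" / "uq_rel TYPE('p)"
  by (rule equivp_uq_rel)

text \<open>The character sending \<open>E, F\<close> to 0 and \<open>K, Kinv\<close> to 1 shows that the quotient is
  nontrivial, as \<^class>\<open>ring_1\<close> requires.\<close>

fun counit_word :: "generator free_word \<Rightarrow> complex" where
  "counit_word (Word w) = (if GenE \<in> set w \<or> GenF \<in> set w then 0 else 1)"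

definition counit :: "generator free_alg \<Rightarrow> complex" where
  "counit f = (\<Sum>w\<in>Poly_Mapping.keys f. Poly_Mapping.lookup f w * counit_word w)"

lemma counit_single: "counit (Poly_Mapping.single w c) = c * counit_word w"
  by (simp add: counit_def)

lemma counit_add: "counit (f + g) = counit f + counit g"
  unfolding counit_def by (rule setsum_keys_plus_distrib) (simp_all add: distrib_right)

lemma counit_word_add: "counit_word (u + v) = counit_word u * counit_word v"
  by (cases u; cases v) auto

lemma counit_mult: "counit (f * g) = counit f * counit g"
proof (induction f rule: free_alg_induct)
  case (single w c)
  show ?case
    by (induction g rule: free_alg_induct)
       (simp_all add: mult_single counit_single counit_word_add distrib_left counit_add)
qed (simp add: distrib_right counit_add)

lemma counit_0: "counit 0 = 0"
  by (simp add: counit_def)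

lemma counit_1: "counit 1 = 1"
proof -
  have "counit_word 0 = 1" by (simp add: zero_free_word_def)
  then show ?thesis using counit_single[of 0 1] by simp
qed

lemma counit_diff: "counit (f - g) = counit f - counit g"
  using counit_add[of "f - g" g] by simp

lemma counit_power: "counit (f ^ n) = counit f ^ n"
  by (induction n) (simp_all add: counit_1 counit_mult)

lemma counit_uq_ideal:
  assumes "x \<in> uq_ideal p" "p > 0"
  shows "counit x = 0"
  using assms(1) unfolding uq_ideal_def
proof (induction rule: two_sided_ideal_gen.induct)
  case (base r)
  then show ?case using assms(2)
    by (auto simp: uq_relators_def Let_def counit_diff counit_mult counit_power counit_1
        free_gen_def counit_single)
qed (simp_all add: counit_0 counit_add counit_mult)

instantiation uqsl2 :: (finite) ring_1
begin

lift_definition zero_uqsl2 :: "'a uqsl2" is 0 .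
lift_definition one_uqsl2 :: "'a uqsl2" is 1 .

lift_definition plus_uqsl2 :: "'a uqsl2 \<Rightarrow> 'a uqsl2 \<Rightarrow> 'a uqsl2" is "(+)"
proof -
  fix a b c d :: "generator free_alg"
  assume "uq_rel TYPE('a) a b" "uq_rel TYPE('a) c d"
  then have "(a - b) + (c - d) \<in> uq_ideal CARD('a)"
    unfolding uq_rel_def uq_ideal_def by (rule two_sided_ideal_gen.add)
  moreover have "(a - b) + (c - d) = (a + c) - (b + d)" by simp
  ultimately show "uq_rel TYPE('a) (a + c) (b + d)"
    by (simp only: uq_rel_def)
qed

lift_definition minus_uqsl2 :: "'a uqsl2 \<Rightarrow> 'a uqsl2 \<Rightarrow> 'a uqsl2" is "(-)"
proof -
  fix a b c d :: "generator free_alg"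
  assume "uq_rel TYPE('a) a b" "uq_rel TYPE('a) c d"
  then have "(a - b) - (c - d) \<in> uq_ideal CARD('a)"
    unfolding uq_rel_def uq_ideal_def by (rule two_sided_ideal_gen_diff)
  moreover have "(a - b) - (c - d) = (a - c) - (b - d)" by simp
  ultimately show "uq_rel TYPE('a) (a - c) (b - d)"
    by (simp only: uq_rel_def)
qed

lift_definition uminus_uqsl2 :: "'a uqsl2 \<Rightarrow> 'a uqsl2" is uminus
proof -
  fix a b :: "generator free_alg"
  assume "uq_rel TYPE('a) a b"
  then have "- (a - b) \<in> uq_ideal CARD('a)"
    unfolding uq_rel_def uq_ideal_def by (rule two_sided_ideal_gen_uminus)
  moreover have "- (a - b) = (- a) - (- b)" by simp
  ultimately show "uq_rel TYPE('a) (- a) (- b)"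
    by (simp only: uq_rel_def)
qed

lift_definition times_uqsl2 :: "'a uqsl2 \<Rightarrow> 'a uqsl2 \<Rightarrow> 'a uqsl2" is "(*)"
proof -
  fix a b c d :: "generator free_alg"
  assume "uq_rel TYPE('a) a b" "uq_rel TYPE('a) c d"
  then have "(a - b) * c + b * (c - d) \<in> uq_ideal CARD('a)"
    unfolding uq_rel_def uq_ideal_def
    by (intro two_sided_ideal_gen.add two_sided_ideal_gen.left two_sided_ideal_gen.right)
  moreover have "(a - b) * c + b * (c - d) = a * c - b * d"
    by (simp add: left_diff_distrib right_diff_distrib)
  ultimately show "uq_rel TYPE('a) (a * c) (b * d)"
    by (simp only: uq_rel_def)
qed

instance
proof
  show "(0 :: 'a uqsl2) \<noteq> 1"
  proof (transfer, rule notI)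
    assume "uq_rel TYPE('a) 0 1"
    then have "counit (0 - 1) = 0"
      unfolding uq_rel_def by (rule counit_uq_ideal) simp
    then show False by (simp only: counit_diff counit_0 counit_1) simp
  qed
qed (transfer, simp add: uq_rel_def uq_ideal_def two_sided_ideal_gen.zero algebra_simps)+

end

lift_definition uqE :: "'p::finite uqsl2" is "free_gen GenE" .
lift_definition uqF :: "'p::finite uqsl2" is "free_gen GenF" .
lift_definition uqK :: "'p::finite uqsl2" is "free_gen GenK" .

lift_definition uq_scalar :: "complex \<Rightarrow> 'p::finite uqsl2" is free_scalar .

definition uq_scale :: "complex \<Rightarrow> 'p::finite uqsl2 \<Rightarrow> 'p uqsl2" where
  "uq_scale c x = uq_scalar c * x"

lemma uq_scalar_add: "uq_scalar (a + b) = uq_scalar a + uq_scalar b"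
  by transfer (simp add: free_scalar_add uq_rel_def uq_ideal_def two_sided_ideal_gen.zero)

lemma uq_scalar_mult: "uq_scalar (a * b) = uq_scalar a * uq_scalar b"
  by transfer (simp add: free_scalar_mult uq_rel_def uq_ideal_def two_sided_ideal_gen.zero)

lemma uq_scalar_1: "uq_scalar 1 = 1"
  by transfer (simp add: free_scalar_1 uq_rel_def uq_ideal_def two_sided_ideal_gen.zero)

lemma uq_scalar_commute: "uq_scalar c * x = x * uq_scalar c"
  by transfer (simp add: free_scalar_commute uq_rel_def uq_ideal_def two_sided_ideal_gen.zero)

lemma uq_scale_mult_left: "uq_scale c x * y = uq_scale c (x * y)"
  by (simp add: uq_scale_def mult.assoc)

lemma uq_scale_mult_right: "x * uq_scale c y = uq_scale c (x * y)"
  unfolding uq_scale_def by (metis mult.assoc uq_scalar_commute)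

global_interpretation uq: vector_space "uq_scale :: complex \<Rightarrow> 'p::finite uqsl2 \<Rightarrow> 'p uqsl2"
  by unfold_locales
     (simp_all add: uq_scale_def distrib_left distrib_right uq_scalar_add uq_scalar_mult
       uq_scalar_1 mult.assoc)


section \<open>The elements spanning the summands\<close>

text \<open>The signs \<open>\<alpha>\<close> are the complex numbers 1 and -1. All truncated subtractions of natural
  numbers below are honest in the stated ranges of the indices.\<close>

definition uq_v :: "complex \<Rightarrow> nat \<Rightarrow> nat \<Rightarrow> 'p::finite uqsl2" where
  "uq_v \<alpha> s t =
    (\<Sum>l=0..2 * CARD('p) - 1.
       uq_scale ((\<alpha> * qroot CARD('p) powi (- (int s - 2 * int t + 1))) ^ l) (uqK ^ l))"

definition uq_a :: "complex \<Rightarrow> nat \<Rightarrow> nat \<Rightarrow> nat \<Rightarrow> 'p::finite uqsl2" where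
  "uq_a \<alpha> s t n = uqF ^ n * uqE ^ (CARD('p) - 1) * uqF ^ (CARD('p) - t) * uq_v \<alpha> s t"

definition uq_mu :: "nat \<Rightarrow> complex \<Rightarrow> nat \<Rightarrow> nat \<Rightarrow> complex" where
  "uq_mu p \<alpha> s m = (\<Prod>j=p - s - (m - 1)..p - s - 1. - \<alpha> * qint p j * qint p (p - s - j))"

definition uq_b :: "complex \<Rightarrow> nat \<Rightarrow> nat \<Rightarrow> nat \<Rightarrow> 'p::finite uqsl2" where
  "uq_b \<alpha> s t n =
    uqF ^ n * (\<Sum>m=1..CARD('p) - s.
       uq_scale (uq_mu CARD('p) \<alpha> s m)
         (uqE ^ (CARD('p) - m - 1) * uqF ^ (CARD('p) - t - m) * uq_v \<alpha> s t))"

definition uq_y :: "complex \<Rightarrow> nat \<Rightarrow> nat \<Rightarrow> nat \<Rightarrow> 'p::finite uqsl2" where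
  "uq_y \<alpha> s t k = uqF ^ (s + k) * uq_b \<alpha> s t 0"

definition uq_x :: "complex \<Rightarrow> nat \<Rightarrow> nat \<Rightarrow> nat \<Rightarrow> 'p::finite uqsl2" where
  "uq_x \<alpha> s t k =
    uq_scale
      (1 / (\<Prod>i=k + 1..CARD('p) - s - 1. - \<alpha> * qint CARD('p) i * qint CARD('p) (CARD('p) - s - i)))
      (uqE ^ (CARD('p) - s - k - 1) * (\<Sum>m=1..CARD('p) - s.
         uq_scale (uq_mu CARD('p) \<alpha> s m)
           (uqE ^ (CARD('p) - m) * uqF ^ (CARD('p) - t - m) * uq_v \<alpha> s t)))"

definition X_ideal :: "complex \<Rightarrow> nat \<Rightarrow> 'p::finite uqsl2 set" where
  "X_ideal \<alpha> t = uq.span {uq_a \<alpha> CARD('p) t n | n. n \<le> CARD('p) - 1}"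

definition P_ideal :: "complex \<Rightarrow> nat \<Rightarrow> nat \<Rightarrow> 'p::finite uqsl2 set" where
  "P_ideal \<alpha> s t = uq.span
    ({uq_b \<alpha> s t n | n. n \<le> s - 1} \<union> {uq_a \<alpha> s t n | n. n \<le> s - 1} \<union>
     {uq_x \<alpha> s t k | k. k \<le> CARD('p) - s - 1} \<union> {uq_y \<alpha> s t k | k. k \<le> CARD('p) - s - 1})"


section \<open>Internal direct sums of left ideals\<close>

definition left_ideal :: "'a::ring_1 set \<Rightarrow> bool" where
  "left_ideal L \<longleftrightarrow>
    0 \<in> L \<and> (\<forall>x\<in>L. \<forall>y\<in>L. x + y \<in> L) \<and> (\<forall>a. \<forall>x\<in>L. a * x \<in> L)"

definition ring_direct_sum_of_left_ideals :: "'i set \<Rightarrow> ('i \<Rightarrow> 'a::ring_1 set) \<Rightarrow> bool" where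
  "ring_direct_sum_of_left_ideals I L \<longleftrightarrow>
    finite I \<and> (\<forall>i\<in>I. left_ideal (L i)) \<and>
    (\<forall>x. \<exists>!f. f \<in> (\<Pi>\<^sub>E i\<in>I. L i) \<and> x = (\<Sum>i\<in>I. f i))"

datatype summand = P complex nat nat | X complex nat

fun summand_ideal :: "summand \<Rightarrow> 'p::finite uqsl2 set" where
  "summand_ideal (P \<alpha> s t) = P_ideal \<alpha> s t"
| "summand_ideal (X \<alpha> t) = X_ideal \<alpha> t"

end

theory Submission
  imports Defs
begin

text \<open>No basis of the algebra is needed. Independence: right multiplication by \<open>K\<close> acts on a summand
  by the scalar \<open>\<alpha>q^(s-2t+1)\<close>, and the central Casimir element \<open>C\<close> acts with the single generalised
  eigenvalue \<open>\<alpha>(q^s + q^-s)/(q - q^-1)^2\<close>; the pairs of these two numbers are distinct.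

  Exhaustion: 1 is a combination of the \<open>K\<close>-eigenvectors \<open>v\<close>. On such a \<open>v\<close> the relation \<open>F^p E^p v = 0\<close>
  reads \<open>\<Prod>(C - r) v = 0\<close>, where each root \<open>r\<close> is the Casimir eigenvalue of a summand
  attached to \<open>v\<close>. That summand contains \<open>c v + h (C - r) v\<close> with \<open>c \<noteq> 0\<close>, so in the sum
  of all the summands the factor \<open>C - r\<close> can be cancelled; after \<open>p\<close> steps \<open>v\<close> itself is reached.

  In \<open>P_ideal \<alpha> s t\<close> the generator \<open>b = b_0\<close> satisfies \<open>(C - r) b = a_0\<close> and \<open>(C - r) a_0 = 0\<close>
  (a telescoping sum), which determines the action of \<open>E\<close> and \<open>F\<close> on the spanning vectors.\<close>

section \<open>Presentation\<close>

lift_definition uqKinv :: "'p::finite uqsl2" is "free_gen GenKinv" .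

lemma uq_relations:
  defines "q \<equiv> qroot CARD('p::finite)"
  shows uqK_Kinv: "uqK * uqKinv = (1 :: 'p uqsl2)"
    and uqKinv_K: "uqKinv * uqK = (1 :: 'p uqsl2)"
    and uqK_E_Kinv: "uqK * uqE * uqKinv = (uq_scale (q ^ 2) uqE :: 'p uqsl2)"
    and uqK_F_Kinv: "uqK * uqF * uqKinv = (uq_scale (inverse q ^ 2) uqF :: 'p uqsl2)"
    and uqE_F: "uqE * uqF - uqF * uqE = (uq_scale (1 / (q - inverse q)) (uqK - uqKinv) :: 'p uqsl2)"
proof -
  have *: "uq_rel TYPE('p) x y" if "x - y \<in> uq_relators CARD('p)" for x y
    using that by (simp add: uq_rel_def uq_ideal_def two_sided_ideal_gen.base)
  show "uqK * uqKinv = (1 :: 'p uqsl2)" "uqKinv * uqK = (1 :: 'p uqsl2)"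
    "uqK * uqE * uqKinv = (uq_scale (q ^ 2) uqE :: 'p uqsl2)"
    "uqK * uqF * uqKinv = (uq_scale (inverse q ^ 2) uqF :: 'p uqsl2)"
    "uqE * uqF - uqF * uqE = (uq_scale (1 / (q - inverse q)) (uqK - uqKinv) :: 'p uqsl2)"
    unfolding uq_scale_def q_def
    by (transfer, rule *, simp add: uq_relators_def Let_def)+
qed

text \<open>Powers are not lifted constants of the quotient, so the relations with an exponent are
  checked on representatives.\<close>

lemma abs_uqsl2_power: "abs_uqsl2 x ^ n = (abs_uqsl2 (x ^ n) :: 'p::finite uqsl2)"
  by (induction n) (simp_all add: one_uqsl2.abs_eq times_uqsl2.abs_eq)

lemma uq_powers:
  shows uqE_power: "uqE ^ CARD('p::finite) = (0 :: 'p uqsl2)"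
    and uqF_power: "uqF ^ CARD('p) = (0 :: 'p uqsl2)"
    and uqK_power: "uqK ^ (2 * CARD('p)) = (1 :: 'p uqsl2)"
proof -
  have *: "abs_uqsl2 x = (abs_uqsl2 y :: 'p uqsl2)" if "x - y \<in> uq_relators CARD('p)" for x y
    using that by (simp add: uqsl2.abs_eq_iff uq_rel_def uq_ideal_def two_sided_ideal_gen.base)
  show "uqE ^ CARD('p::finite) = (0 :: 'p uqsl2)" "uqF ^ CARD('p) = (0 :: 'p uqsl2)"
    "uqK ^ (2 * CARD('p)) = (1 :: 'p uqsl2)"
    unfolding uqE_def uqF_def uqK_def zero_uqsl2_def one_uqsl2_def abs_uqsl2_power
      map_fun_def id_def comp_def
    by (rule *, simp add: uq_relators_def Let_def)+
qed

text \<open>The quotient map is onto, and every monomial is a scalar times a product of letters.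
  This reduces centrality of the Casimir element and closure of a span under left multiplication to
  the generators.\<close>

lemma uq_induct [case_names E F K Kinv scalar add mult]:
  fixes x :: "'p::finite uqsl2"
  assumes gens: "Q uqE" "Q uqF" "Q uqK" "Q uqKinv" "\<And>c. Q (uq_scalar c)"
    and add: "\<And>x y. Q x \<Longrightarrow> Q y \<Longrightarrow> Q (x + y)"
    and mult: "\<And>x y. Q x \<Longrightarrow> Q y \<Longrightarrow> Q (x * y)"
  shows "Q x"
proof -
  obtain f where f: "x = abs_uqsl2 f" by (induction x rule: uqsl2.abs_induct) blast
  have "Q (abs_uqsl2 f)"
  proof (induction f rule: free_alg_induct)
    case (single w c)
    have gen: "Q (abs_uqsl2 (free_gen g))" for g
      using gens by (cases g) (simp_all add: uqE_def uqF_def uqK_def uqKinv_def)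
    have "Q (abs_uqsl2 (Poly_Mapping.single (Word u) c))" for u
    proof (induction u)
      case Nil
      then show ?case
        using gens(5)[of c] by (simp add: uq_scalar_def free_scalar_def zero_free_word_def)
    next
      case (Cons g u)
      have "Poly_Mapping.single (Word (g # u)) c = free_gen g * Poly_Mapping.single (Word u) c"
        by (simp add: free_gen_def mult_single)
      then show ?case
        using mult[OF gen Cons.IH] by (simp add: times_uqsl2.abs_eq)
    qed
    then show ?case by (cases w) simp
  next
    case (add f g)
    then show ?case using assms(6) by (simp add: plus_uqsl2.abs_eq[symmetric])
  qed
  then show ?thesis using f by simp
qed

section \<open>Scalars\<close>

lemma qroot_nonzero [simp]: "qroot p \<noteq> 0"
  by (simp add: qroot_def)

lemma qroot_powi: "qroot p powi n = cis (pi * of_int n / real p)"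
proof -
  have "qroot p = cis (pi / real p)"
    by (simp add: qroot_def cis_conv_exp mult.commute)
  then show ?thesis by (simp add: cis_power_int mult.commute)
qed

text \<open>Through \<open>cis\<close> the equation says that two arguments agree modulo 2 pi; in
  other words q has order exactly 2p.\<close>

lemma qroot_powi_eq_iff:
  assumes "p > 0"
  shows "qroot p powi m = qroot p powi n \<longleftrightarrow> 2 * int p dvd m - n"
proof -
  have "qroot p powi m = qroot p powi n \<longleftrightarrow>
      (\<exists>k::int. pi * of_int m / real p = pi * of_int n / real p + 2 * pi * of_int k)"
    by (auto simp: qroot_powi complex_eq_iff sin_cos_eq_iff[symmetric])
  also have "\<dots> \<longleftrightarrow> (\<exists>k::int. m = n + 2 * int p * k)"
  proof (intro ex_cong1)
    fix k :: int
    have "pi * of_int m / real p = pi * of_int n / real p + 2 * pi * of_int k \<longleftrightarrow>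
        pi * of_int m = pi * (of_int n + 2 * real p * of_int k)"
      using assms by (simp add: field_simps)
    also have "\<dots> \<longleftrightarrow> real_of_int m = of_int (n + 2 * int p * k)"
      by simp
    finally show "pi * of_int m / real p = pi * of_int n / real p + 2 * pi * of_int k \<longleftrightarrow>
        m = n + 2 * int p * k"
      by (simp only: of_int_eq_iff)
  qed
  also have "\<dots> \<longleftrightarrow> 2 * int p dvd m - n"
    by (auto simp: dvd_def algebra_simps)
  finally show ?thesis .
qed

lemma qroot_power_p: "p > 0 \<Longrightarrow> qroot p ^ p = - 1"
  using qroot_powi[of p "int p"] by simp

lemma qroot_powi_add_p: "p > 0 \<Longrightarrow> qroot p powi (n + int p) = - (qroot p powi n)"
  by (simp add: power_int_add qroot_power_p)

lemma qroot_diff_nonzero: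
  assumes "p \<ge> 2"
  shows "qroot p - inverse (qroot p) \<noteq> 0"
proof
  assume "qroot p - inverse (qroot p) = 0"
  then have "qroot p powi 1 = qroot p powi (-1)" by (simp add: power_int_minus)
  then have "2 * int p dvd 2" using assms by (subst (asm) qroot_powi_eq_iff) auto
  then show False using assms by (auto dest: zdvd_imp_le)
qed

text \<open>Extends \<open>qint\<close> to integers, because differences of Casimir values involve
  arguments such as s - u that can be negative.\<close>

definition qbracket :: "nat \<Rightarrow> int \<Rightarrow> complex" where
  "qbracket p n = (qroot p powi n - qroot p powi (- n)) / (qroot p - inverse (qroot p))"

lemma qint_eq_qbracket: "qint p n = qbracket p (int n)"
  by (simp add: qint_def qbracket_def power_int_minus power_inverse)

lemma qbracket_diff_p: "p > 0 \<Longrightarrow> qbracket p (int p - n) = qbracket p n"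
  using qroot_powi_add_p[of p "- n"] qroot_powi_add_p[of p "n - int p"]
  by (simp add: qbracket_def)

lemma qbracket_eq_0_iff:
  assumes "p \<ge> 2"
  shows "qbracket p n = 0 \<longleftrightarrow> int p dvd n"
proof -
  have "qbracket p n = 0 \<longleftrightarrow> qroot p powi n = qroot p powi (- n)"
    using qroot_diff_nonzero[OF assms] by (simp add: qbracket_def)
  also have "\<dots> \<longleftrightarrow> 2 * int p dvd 2 * n"
    using assms by (subst qroot_powi_eq_iff) auto
  finally show ?thesis by simp
qed

lemma qbracket_eq_0D: "qbracket p n = 0 \<Longrightarrow> p \<ge> 2 \<Longrightarrow> n \<le> 0 \<or> int p \<le> n"
  by (auto simp: qbracket_eq_0_iff dest: zdvd_imp_le)

text \<open>The scalar by which the Casimir element acts on a vector of weight w killed by E, for z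
  = w q, or killed by F, for z = w / q. It is the same for z and 1/z.\<close>

definition casimir_value :: "nat \<Rightarrow> complex \<Rightarrow> complex" where
  "casimir_value p z = (z + inverse z) / (qroot p - inverse (qroot p)) ^ 2"

lemma casimir_value_eq_iff:
  assumes "p \<ge> 2" "z \<noteq> 0" "w \<noteq> 0"
  shows "casimir_value p z = casimir_value p w \<longleftrightarrow> z = w \<or> z * w = 1"
proof -
  have "casimir_value p z = casimir_value p w \<longleftrightarrow> z + inverse z = w + inverse w"
    using qroot_diff_nonzero[OF assms(1)] by (simp add: casimir_value_def)
  also have "\<dots> \<longleftrightarrow> (z - w) * (z * w - 1) = 0"
    using assms by (auto simp: field_simps)
  finally show ?thesis by simp
qed

text \<open>Expanding the product of the brackets gives four powers of q, which pair up into the two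
  Casimir values; a sign is its own inverse. This is how quantum integers enter the
  coefficients.\<close>

lemma casimir_value_diff:
  assumes "\<alpha> \<in> {1, -1}"
  shows "casimir_value p (\<alpha> * qroot p powi s) - casimir_value p (\<alpha> * qroot p powi (s - 2 * u)) =
    \<alpha> * qbracket p u * qbracket p (s - u)"
proof -
  let ?q = "qroot p"
  have "(?q powi u - ?q powi (- u)) * (?q powi (s - u) - ?q powi (- (s - u))) =
      ?q powi (u + (s - u)) - ?q powi (u - (s - u)) - ?q powi (- u + (s - u)) + ?q powi (- u - (s - u))"
    by (simp add: algebra_simps power_int_add[symmetric])
  then have *: "(?q powi u - ?q powi (- u)) * (?q powi (s - u) - ?q powi (- (s - u))) =
      ?q powi s + inverse (?q powi s) - ?q powi (s - 2 * u) - inverse (?q powi (s - 2 * u))"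
    by (simp add: power_int_minus[symmetric])
  have "\<alpha> * qbracket p u * qbracket p (s - u) = \<alpha> *
      ((?q powi u - ?q powi (- u)) * (?q powi (s - u) - ?q powi (- (s - u)))) / (?q - inverse ?q) ^ 2"
    by (simp add: qbracket_def power2_eq_square)
  also have "\<dots> = casimir_value p (\<alpha> * ?q powi s) - casimir_value p (\<alpha> * ?q powi (s - 2 * u))"
    using assms unfolding *
    by (auto simp: casimir_value_def diff_divide_distrib[symmetric] algebra_simps)
  finally show ?thesis ..
qed

section \<open>Which summands share a weight or a Casimir value\<close>

lemma sign_eq_qroot_powi:
  assumes "\<alpha> \<in> {1, -1}" "p > 0"
  obtains e where "e = 0 \<or> e = int p" "\<alpha> = qroot p powi e" "\<alpha> = 1 \<longleftrightarrow> e = 0"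
proof (cases "\<alpha> = 1")
  case True
  then show ?thesis using that[of 0] by simp
next
  case False
  then show ?thesis using that[of "int p"] assms by (simp add: qroot_power_p)
qed

text \<open>Since q^p = -1, signs are absorbed into exponents and both equations become congruences
  modulo 2p. Equal Casimir values leave s' = s with equal signs or s' = p - s with opposite signs.
  In the second case the weights would force 2(s - t + t') to be a multiple of 2p, yet it lies
  strictly between 0 and 2p.\<close>

lemma weight_casimir_value_inj:
  assumes p: "p \<ge> 2"
    and "\<alpha> \<in> {1, -1}" "\<beta> \<in> {1, -1}"
    and st: "1 \<le> t" "t \<le> s" "s \<le> p" "1 \<le> t'" "t' \<le> s'" "s' \<le> p"
    and weight: "\<alpha> * qroot p powi (int s - 2 * int t + 1) = \<beta> * qroot p powi (int s' - 2 * int t' + 1)"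
    and val: "casimir_value p (\<alpha> * qroot p powi int s) = casimir_value p (\<beta> * qroot p powi int s')"
  shows "\<alpha> = \<beta> \<and> s = s' \<and> t = t'"
proof -
  obtain e where e: "e = 0 \<or> e = int p" "\<alpha> = qroot p powi e" "\<alpha> = 1 \<longleftrightarrow> e = 0"
    using sign_eq_qroot_powi[OF assms(2)] p by (metis gr0I not_numeral_le_zero)
  obtain f where f: "f = 0 \<or> f = int p" "\<beta> = qroot p powi f" "\<beta> = 1 \<longleftrightarrow> f = 0"
    using sign_eq_qroot_powi[OF assms(3)] p by (metis gr0I not_numeral_le_zero)
  have small: "x = 0" if "2 * int p dvd x" "\<bar>x\<bar> < 2 * int p" for x
    using that dvd_imp_le_int[of x "2 * int p"] by (cases "x = 0") auto
  have "qroot p powi (e + (int s - 2 * int t + 1)) = qroot p powi (f + (int s' - 2 * int t' + 1))"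
    using weight by (simp add: e(2) f(2) power_int_add)
  then have w: "2 * int p dvd e + (int s - 2 * int t + 1) - (f + (int s' - 2 * int t' + 1))"
    using p by (simp only: qroot_powi_eq_iff)
  have "casimir_value p (qroot p powi (e + int s)) = casimir_value p (qroot p powi (f + int s'))"
    using val by (simp add: e(2) f(2) power_int_add)
  then have "qroot p powi (e + int s) = qroot p powi (f + int s') \<or>
      qroot p powi (e + int s + (f + int s')) = qroot p powi 0"
    using p by (subst (asm) casimir_value_eq_iff) (simp_all add: power_int_add)
  then have c: "2 * int p dvd e + int s - (f + int s') \<or> 2 * int p dvd e + int s + (f + int s') - 0"
    using p by (simp only: qroot_powi_eq_iff)
  show ?thesis
  proof (cases "e = f")
    case True
    have "s = s'"
      using c
    proof
      assume "2 * int p dvd e + int s - (f + int s')"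
      then have "int s - int s' = 0"
        using True st by (intro small) auto
      then show ?thesis by simp
    next
      assume "2 * int p dvd e + int s + (f + int s') - 0"
      \<comment> \<open>Here 2e is 0 or 2p; removing a multiple of 2p leaves a number of absolute
        value below 2p, which forces s = s' = p.\<close>
      then have "2 * int p dvd (int s + int s' - 2 * int p) + 2 * int p * (if e = 0 then 1 else 2)"
        using True e(1) by (auto simp: algebra_simps)
      then have "2 * int p dvd int s + int s' - 2 * int p"
        by (simp add: dvd_add_left_iff)
      then have "int s + int s' - 2 * int p = 0"
        using st by (intro small) auto
      then show ?thesis using st by simp
    qed
    moreover have "2 * int t' - 2 * int t = 0"
      using w True \<open>s = s'\<close> st by (intro small) (auto simp: algebra_simps)
    ultimately show ?thesis using True e f by simp
  next
    case False
    show ?thesis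
      using c
    proof
      assume "2 * int p dvd e + int s - (f + int s')"
      then have "e + int s - (f + int s') = 0"
        using False e(1) f(1) st by (intro small) auto
      then show ?thesis using False e(1) f(1) st by auto
    next
      assume "2 * int p dvd e + int s + (f + int s') - 0"
      moreover have "e + int s + (f + int s') - 0 = (int s + int s' - int p) + 2 * int p"
        using False e(1) f(1) by auto
      ultimately have "2 * int p dvd (int s + int s' - int p) + 2 * int p"
        by (simp only:)
      then have "2 * int p dvd int s + int s' - int p"
        by (simp only: dvd_add_left_iff[OF dvd_refl])
      then have "int s + int s' - int p = 0"
        using st by (intro small) linarith+
      then have s': "int s' = int p - int s" by simp
      have "2 * int p dvd 2 * (int s - int t + int t') + 2 * int p * (if e = 0 then -1 else 0)"
        using w False e(1) f(1) by (auto simp: s' algebra_simps)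
      then have "2 * int p dvd 2 * (int s - int t + int t')"
        by (simp add: dvd_add_left_iff)
      then have "2 * (int s - int t + int t') = 0"
        using st s' by (intro small) auto
      then show ?thesis using st by simp
    qed
  qed
qed

text \<open>Up to sign and inversion, the Casimir parameter of a root is some \<open>q^n\<close> with
  \<open>1 \<le> n \<le> p\<close>; the block \<open>(\<beta>, n)\<close> and the linked block \<open>(-\<beta>, p - n)\<close> share it, and exactly one of
  the two admits an index \<open>t\<close> of the given weight.\<close>

lemma casimir_root_index:
  assumes p: "p \<ge> 2" and "k < p"
  obtains \<alpha> s t where "\<alpha> \<in> {1, -1}" "1 \<le> t" "t \<le> s" "s \<le> p"
    "\<alpha> * qroot p powi (int s - 2 * int t + 1) = qroot p powi l"
    "casimir_value p (qroot p powi (l + 2 * int k + 1)) = casimir_value p (\<alpha> * qroot p powi int s)"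
proof -
  \<comment> \<open>Division by p with the remainder taken from 1 to p: the exponent l + 2k + 1 is p
    times the quotient plus n, and each p contributes a factor -1 to \<open>\<beta>\<close>.\<close>
  define n where "n = nat ((l + 2 * int k) mod int p) + 1"
  define \<beta> :: complex where "\<beta> = (-1) powi ((l + 2 * int k) div int p)"
  have n: "1 \<le> n" "n \<le> p"
    using p by (auto simp: n_def nat_less_iff Suc_le_eq)
  have \<beta>: "\<beta> \<in> {1, -1}"
    by (auto simp: \<beta>_def power_int_def minus_one_power_iff)
  have z: "qroot p powi (l + 2 * int k + 1) = \<beta> * qroot p powi int n"
  proof -
    have "l + 2 * int k + 1 = int p * ((l + 2 * int k) div int p) + int n"
      using p by (simp add: n_def)
    then have "qroot p powi (l + 2 * int k + 1) =
        (qroot p powi int p) powi ((l + 2 * int k) div int p) * qroot p powi int n"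
      by (metis power_int_add power_int_mult qroot_nonzero)
    then show ?thesis using p by (simp add: qroot_power_p \<beta>_def)
  qed
  have l: "qroot p powi l = \<beta> * qroot p powi (int n - (2 * int k + 1))"
  proof -
    have "qroot p powi l = qroot p powi (l + 2 * int k + 1) / qroot p powi (2 * int k + 1)"
      by (subst power_int_diff[symmetric]) simp_all
    then show ?thesis unfolding z by (metis power_int_diff qroot_nonzero times_divide_eq_right)
  qed
  show ?thesis
  proof (cases "k + 1 \<le> n")
    case True
    then show ?thesis using that[of \<beta> "k + 1" n] n \<beta> z l by (simp add: algebra_simps)
  next
    case False
    \<comment> \<open>The linked block: its parameter is the inverse of the one at hand, so the
      Casimir value is the same, and t = k + 1 - n restores the weight.\<close>
    have 1: "- \<beta> * qroot p powi (int p - int n) = inverse (\<beta> * qroot p powi int n)"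
      using \<beta> qroot_powi_add_p[of p "- int n"] p by (auto simp: power_int_minus)
    have "qroot p powi l = \<beta> * qroot p powi (int (p - n) - 2 * int (k + 1 - n) + 1 - int p)"
      using l n False by (simp add: algebra_simps)
    also have "\<dots> = - \<beta> * qroot p powi (int (p - n) - 2 * int (k + 1 - n) + 1)"
      using qroot_powi_add_p[of p "int (p - n) - 2 * int (k + 1 - n) + 1 - int p"] p by simp
    finally have "- \<beta> * qroot p powi (int (p - n) - 2 * int (k + 1 - n) + 1) = qroot p powi l" ..
    moreover have "casimir_value p (qroot p powi (l + 2 * int k + 1)) =
        casimir_value p (- \<beta> * qroot p powi int (p - n))"
      using 1 n z by (simp add: of_nat_diff casimir_value_def)
    ultimately show ?thesis
      using that[of "- \<beta>" "k + 1 - n" "p - n"] n \<beta> False \<open>k < p\<close> by auto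
  qed
qed

section \<open>Orthogonality of the powers of q\<close>

lemma qroot_powi_root_of_unity:
  assumes "p > 0"
  shows "(qroot p powi l) ^ (2 * p) = 1"
proof -
  have "(qroot p powi l) ^ (2 * p) = qroot p powi (l * int (2 * p))"
    by (simp only: power_int_mult power_int_of_nat)
  also have "\<dots> = qroot p powi 0"
    unfolding qroot_powi_eq_iff[OF assms] by simp
  finally show ?thesis by simp
qed

text \<open>A geometric sum in x = q^(-l), a 2p-th root of unity that differs from 1 for these
  l.\<close>

lemma sum_qroot_power:
  assumes "0 < l" "l < 2 * p"
  shows "(\<Sum>j<2 * p. inverse (qroot p powi int j) ^ l) = 0"
proof -
  define x where "x = qroot p powi (- int l)"
  have p: "p > 0" using assms by simp
  have "x \<noteq> qroot p powi 0"
    unfolding x_def qroot_powi_eq_iff[OF p] using assms by (auto dest: zdvd_imp_le)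
  moreover have "x ^ (2 * p) = 1"
    unfolding x_def by (rule qroot_powi_root_of_unity[OF p])
  ultimately have "(\<Sum>j<2 * p. x ^ j) = 0"
    by (simp add: geometric_sum)
  moreover have "inverse (qroot p powi int j) ^ l = x ^ j" for j
    by (simp add: x_def power_int_minus power_inverse flip: power_mult) (simp add: mult.commute)
  ultimately show ?thesis by simp
qed

section \<open>The Casimir element\<close>

lemma uqK_uqE: "uqK * uqE = (uq_scale (qroot CARD('p) ^ 2) (uqE * uqK) :: 'p::finite uqsl2)"
proof -
  have "uqK * uqE = uqK * uqE * uqKinv * (uqK :: 'p uqsl2)"
    by (simp add: mult.assoc uqKinv_K)
  then show ?thesis by (simp add: uqK_E_Kinv uq_scale_mult_left)
qed

lemma uqK_uqF: "uqK * uqF = (uq_scale (inverse (qroot CARD('p)) ^ 2) (uqF * uqK) :: 'p::finite uqsl2)"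
proof -
  have "uqK * uqF = uqK * uqF * uqKinv * (uqK :: 'p uqsl2)"
    by (simp add: mult.assoc uqKinv_K)
  then show ?thesis by (simp add: uqK_F_Kinv uq_scale_mult_left)
qed

lemma uqKinv_commute:
  fixes x :: "'p::finite uqsl2"
  assumes "uqK * x = uq_scale c (x * uqK)" "c \<noteq> 0"
  shows "uqKinv * x = uq_scale (inverse c) (x * uqKinv)"
proof -
  have "uq_scale (inverse c) (x * uqKinv) = uq_scale (inverse c) (uqKinv * (uqK * x) * uqKinv)"
    by (simp add: mult.assoc[symmetric] uqKinv_K)
  also have "\<dots> = uqKinv * x * (uqK * uqKinv)"
    using assms by (simp add: uq_scale_mult_left uq_scale_mult_right mult.assoc)
  finally show ?thesis by (simp add: uqK_Kinv)
qed

definition casimir :: "'p::finite uqsl2" where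
  "casimir = uqF * uqE + uq_scale (1 / (qroot CARD('p) - inverse (qroot CARD('p))) ^ 2)
     (uq_scale (qroot CARD('p)) uqK + uq_scale (inverse (qroot CARD('p))) uqKinv)"

text \<open>Follows from the relation for E F - F E and 1/d = (q - 1/q)/d^2, where d = q - 1/q. The
  two forms of the Casimir element evaluate F E and E F respectively.\<close>

lemma casimir_alt:
  assumes "CARD('p::finite) \<ge> 2"
  shows "(casimir :: 'p uqsl2) = uqE * uqF + uq_scale (1 / (qroot CARD('p) - inverse (qroot CARD('p))) ^ 2)
     (uq_scale (inverse (qroot CARD('p))) uqK + uq_scale (qroot CARD('p)) uqKinv)"
proof -
  define q where "q = qroot CARD('p)"
  define d where "d = q - inverse q"
  have d: "d \<noteq> 0" using qroot_diff_nonzero[OF assms] by (simp add: d_def q_def)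
  have 1: "1 / d + 1 / d ^ 2 * inverse q = 1 / d ^ 2 * q" "1 / d ^ 2 * q - 1 / d = 1 / d ^ 2 * inverse q"
  proof -
    have "1 / d = (q - inverse q) / d ^ 2"
      using d by (simp add: d_def[symmetric] power2_eq_square)
    then show "1 / d + 1 / d ^ 2 * inverse q = 1 / d ^ 2 * q"
      "1 / d ^ 2 * q - 1 / d = 1 / d ^ 2 * inverse q"
      by (simp_all add: diff_divide_distrib)
  qed
  have "uqE * uqF = uqF * uqE + (uq_scale (1 / d) uqK - uq_scale (1 / d) uqKinv :: 'p uqsl2)"
    using uqE_F[where 'p='p] by (simp add: d_def q_def algebra_simps uq.scale_right_diff_distrib)
  then have "uqE * uqF + uq_scale (1 / d ^ 2) (uq_scale (inverse q) uqK + uq_scale q uqKinv) =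
      uqF * uqE + (uq_scale (1 / d + 1 / d ^ 2 * inverse q) uqK +
        uq_scale (1 / d ^ 2 * q - 1 / d) uqKinv :: 'p uqsl2)"
    by (simp add: uq.scale_right_distrib uq.scale_left_distrib uq.scale_left_diff_distrib)
  also have "\<dots> = casimir"
    unfolding 1 by (simp add: casimir_def d_def q_def uq.scale_right_distrib)
  finally show ?thesis by (simp add: d_def q_def)
qed

text \<open>Against E, the left \<open>casimir\<close> is written with E F and the right one with F
  E, so that E F E occurs on both sides and only the parts in K remain to be compared; against F the
  roles are exchanged. K commutes with F E because the factors q^2 and q^(-2) cancel.\<close>

lemma casimir_central:
  assumes card: "CARD('p::finite) \<ge> 2"
  shows "casimir * x = (x * casimir :: 'p uqsl2)"
proof (induction x rule: uq_induct)
  case E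
  have "uqKinv * uqE = (uq_scale (inverse (qroot CARD('p) ^ 2)) (uqE * uqKinv) :: 'p uqsl2)"
    by (rule uqKinv_commute[OF uqK_uqE]) simp
  then show ?case
    by (subst casimir_alt[OF card], subst casimir_def)
      (simp add: algebra_simps uqK_uqE uq_scale_mult_left uq_scale_mult_right
        uq.scale_right_distrib power2_eq_square)
next
  case F
  have "uqKinv * uqF = (uq_scale (inverse (inverse (qroot CARD('p)) ^ 2)) (uqF * uqKinv) :: 'p uqsl2)"
    by (rule uqKinv_commute[OF uqK_uqF]) simp
  then show ?case
    by (subst casimir_def, subst casimir_alt[OF card])
      (simp add: algebra_simps uqK_uqF uq_scale_mult_left uq_scale_mult_right
        uq.scale_right_distrib power2_eq_square)
next
  case K
  have "uqK * (uqF * uqE) = uqK * uqF * (uqE :: 'p uqsl2)" by (simp add: mult.assoc)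
  also have "\<dots> = uq_scale (inverse (qroot CARD('p)) ^ 2) (uqF * (uqK * uqE))"
    by (simp add: uqK_uqF uq_scale_mult_left mult.assoc)
  also have "\<dots> = uqF * (uqE * uqK)"
    by (simp add: uqK_uqE uq_scale_mult_right field_simps)
  finally show ?case
    by (simp add: casimir_def algebra_simps uq_scale_mult_left uq_scale_mult_right
        uqK_Kinv uqKinv_K)
  then have K: "uqK * casimir = (uq_scale 1 (casimir * uqK) :: 'p uqsl2)" by simp
  case Kinv
  show ?case using uqKinv_commute[OF K] by simp
next
  case (scalar c)
  show ?case by (rule uq_scalar_commute[symmetric])
next
  case (add x y)
  then show ?case by (simp add: algebra_simps)
next
  case (mult x y)
  then show ?case by (metis mult.assoc)
qed

text \<open>The factor C - r, indexed by a parameter z of the root r: products of E and F on a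
  weight vector supply z, and z and 1/z give the same element.\<close>

definition casimir_shift :: "complex \<Rightarrow> 'p::finite uqsl2" where
  "casimir_shift z = casimir - uq_scalar (casimir_value CARD('p) z)"

lemma casimir_shift_central:
  assumes "CARD('p::finite) \<ge> 2"
  shows "casimir_shift z * x = (x * casimir_shift z :: 'p uqsl2)"
  by (simp add: casimir_shift_def algebra_simps casimir_central[OF assms] uq_scalar_commute)

lemma casimir_shift_left_commute:
  assumes "CARD('p::finite) \<ge> 2"
  shows "x * (casimir_shift z * y) = casimir_shift z * (x * y :: 'p uqsl2)"
  by (metis assms casimir_shift_central mult.assoc)

lemma casimir_shift_scale:
  "casimir_shift z * uq_scale c x = uq_scale c (casimir_shift z * x)"
  by (rule uq_scale_mult_right)

lemma casimir_shift_change: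
  "casimir_shift w * x = casimir_shift z * x +
    uq_scale (casimir_value CARD('p) z - casimir_value CARD('p) w) (x :: 'p::finite uqsl2)"
  by (simp add: casimir_shift_def uq_scale_def algebra_simps) 
    (metis add.commute diff_add_cancel distrib_right uq_scalar_add)

section \<open>Weight vectors and products of powers of E and F\<close>

definition weight :: "complex \<Rightarrow> 'p::finite uqsl2 \<Rightarrow> bool" where
  "weight w x \<longleftrightarrow> uqK * x = uq_scale w x"

lemma weight_uqKinv:
  assumes "weight w x" "w \<noteq> 0"
  shows "uqKinv * x = uq_scale (inverse w) x"
proof -
  have "x = uqKinv * (uqK * x)" by (simp add: mult.assoc[symmetric] uqKinv_K)
  also have "\<dots> = uq_scale w (uqKinv * x)"
    using assms(1) by (simp add: weight_def uq_scale_mult_right)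
  finally have "uq_scale (inverse w) x = uq_scale (inverse w) (uq_scale w (uqKinv * x))" by simp
  then show ?thesis using assms(2) by simp
qed

lemma weight_scale: "weight w x \<Longrightarrow> weight w (uq_scale c x)"
  by (simp add: weight_def uq_scale_mult_right uq.scale_scale mult.commute)

lemma weight_sum: "(\<And>i. i \<in> I \<Longrightarrow> weight w (f i)) \<Longrightarrow> weight w (sum f I)"
  by (simp add: weight_def sum_distrib_left uq.scale_sum_right)

lemma weight_E: "weight w x \<Longrightarrow> weight (qroot CARD('p) ^ 2 * w) (uqE * x :: 'p::finite uqsl2)"
  by (simp add: weight_def mult.assoc[symmetric] uqK_uqE uq_scale_mult_left)
    (simp add: mult.assoc uq_scale_mult_right)

lemma weight_F:
  "weight w x \<Longrightarrow> weight (inverse (qroot CARD('p)) ^ 2 * w) (uqF * x :: 'p::finite uqsl2)"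
  by (simp add: weight_def mult.assoc[symmetric] uqK_uqF uq_scale_mult_left)
    (simp add: mult.assoc uq_scale_mult_right)

lemma weight_E_power:
  "weight w x \<Longrightarrow> weight (w * qroot CARD('p) powi (2 * int n)) (uqE ^ n * x :: 'p::finite uqsl2)"
proof (induction n)
  case (Suc n)
  show ?case
    using weight_E[OF Suc.IH[OF Suc.prems]]
    by (simp add: power_int_add power2_eq_square mult_ac distrib_left)
qed simp

lemma weight_F_power:
  "weight w x \<Longrightarrow> weight (w * qroot CARD('p) powi (- 2 * int n)) (uqF ^ n * x :: 'p::finite uqsl2)"
proof (induction n)
  case (Suc n)
  have "qroot CARD('p) powi (- 2 * int (Suc n)) =
      qroot CARD('p) powi (- 2 * int n) * inverse (qroot CARD('p)) ^ 2"
    by (simp add: distrib_left power_int_diff power_int_minus field_simps)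
  then show ?case
    using weight_F[OF Suc.IH[OF Suc.prems]] by (simp add: mult_ac)
qed simp

text \<open>By definition \<open>casimir\<close> differs from F E by an expression in K and its
  inverse, and on weight w this is the scalar \<open>casimir_value\<close> at w q.\<close>

lemma F_E_weight:
  assumes "weight w x" "w \<noteq> 0"
  shows "uqF * (uqE * x) = (casimir_shift (w * qroot CARD('p)) * x :: 'p::finite uqsl2)"
  using assms(1) weight_uqKinv[OF assms]
  by (simp add: casimir_shift_def casimir_def weight_def casimir_value_def uq_scale_def[symmetric]
      algebra_simps uq_scale_mult_left add_divide_distrib uq.scale_left_distrib uq.scale_right_distrib)

lemma E_F_weight:
  assumes "CARD('p::finite) \<ge> 2" "weight w x" "w \<noteq> 0"
  shows "uqE * (uqF * x) = (casimir_shift (w * inverse (qroot CARD('p))) * x :: 'p uqsl2)"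
  using assms(2) weight_uqKinv[OF assms(2,3)]
  by (simp add: casimir_shift_def casimir_alt[OF assms(1)] weight_def casimir_value_def uq_scale_def[symmetric]
      algebra_simps uq_scale_mult_left add_divide_distrib uq.scale_left_distrib uq.scale_right_distrib)

text \<open>The parameters run through a geometric progression because E and F change weights by the
  constant factors q^2 and q^(-2).\<close>

primrec shift_prod :: "complex \<Rightarrow> complex \<Rightarrow> nat \<Rightarrow> 'p::finite uqsl2" where
  "shift_prod w r 0 = 1"
| "shift_prod w r (Suc n) = casimir_shift (w * r ^ n) * shift_prod w r n"

lemma shift_prod_add:
  "shift_prod w r (m + n) = (shift_prod (w * r ^ m) r n * shift_prod w r m :: 'p::finite uqsl2)"
  by (induction n) (simp_all add: power_add mult.assoc)

lemma shift_prod_central: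
  assumes "CARD('p::finite) \<ge> 2"
  shows "shift_prod w r n * x = (x * shift_prod w r n :: 'p uqsl2)"
  by (induction n arbitrary: x)
    (simp_all add: mult.assoc casimir_shift_left_commute[OF assms])

text \<open>The innermost F E acts on E^n x, whose weight is w q^(2n), as a single shift; being
  central, the shift moves out, and the remaining n pairs are treated in the same way.\<close>

lemma F_E_power_weight:
  assumes card: "CARD('p::finite) \<ge> 2" and "weight w x" "w \<noteq> 0"
  shows "uqF ^ n * (uqE ^ n * x) =
    (shift_prod (w * qroot CARD('p)) (qroot CARD('p) ^ 2) n * x :: 'p uqsl2)"
proof (induction n)
  case (Suc n)
  have "uqF ^ Suc n * (uqE ^ Suc n * x) = uqF ^ n * (uqF * (uqE * (uqE ^ n * x)))"
    by (simp only: power_Suc2[of uqF] power_Suc[of uqE] mult.assoc)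
  also have "uqF * (uqE * (uqE ^ n * x)) =
      casimir_shift (w * qroot CARD('p) powi (2 * int n) * qroot CARD('p)) * (uqE ^ n * x)"
    using weight_E_power[OF assms(2)] assms(3) by (intro F_E_weight) auto
  also have "w * qroot CARD('p) powi (2 * int n) * qroot CARD('p) =
      w * qroot CARD('p) * (qroot CARD('p) ^ 2) ^ n"
    by (simp add: power_int_mult)
  finally show ?case
    using Suc by (simp add: casimir_shift_left_commute[OF card] mult.assoc)
qed simp

lemma E_F_power_weight:
  assumes card: "CARD('p::finite) \<ge> 2" and "weight w x" "w \<noteq> 0"
  shows "uqE ^ n * (uqF ^ n * x) =
    (shift_prod (w * inverse (qroot CARD('p))) (inverse (qroot CARD('p)) ^ 2) n * x :: 'p uqsl2)"
proof (induction n)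
  case (Suc n)
  have "uqE ^ Suc n * (uqF ^ Suc n * x) = uqE ^ n * (uqE * (uqF * (uqF ^ n * x)))"
    by (simp only: power_Suc2[of uqE] power_Suc[of uqF] mult.assoc)
  also have "uqE * (uqF * (uqF ^ n * x)) =
      casimir_shift (w * qroot CARD('p) powi (- 2 * int n) * inverse (qroot CARD('p))) * (uqF ^ n * x)"
    using weight_F_power[OF assms(2)] assms(3) by (intro E_F_weight[OF card]) auto
  also have "w * qroot CARD('p) powi (- 2 * int n) * inverse (qroot CARD('p)) =
      w * inverse (qroot CARD('p)) * (inverse (qroot CARD('p)) ^ 2) ^ n"
    by (simp add: power_int_mult power_int_minus power_inverse)
  finally show ?case
    using Suc by (simp add: casimir_shift_left_commute[OF card] mult.assoc)
qed simp

section \<open>Left ideals generated by weight vectors\<close>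

lemma span_mult_closed:
  assumes "\<And>g. g \<in> G \<Longrightarrow> u * g \<in> uq.span G" "x \<in> uq.span G"
  shows "u * x \<in> uq.span G"
  using assms(2)
proof (induction rule: uq.span_induct_alt)
  case base
  then show ?case by (simp add: uq.span_zero)
next
  case (step c g y)
  then show ?case
    by (simp add: distrib_left uq_scale_mult_right uq.span_add uq.span_scale assms(1))
qed

lemma left_ideal_span:
  fixes G :: "'p::finite uqsl2 set"
  assumes "\<And>g. g \<in> G \<Longrightarrow> uqE * g \<in> uq.span G"
    and "\<And>g. g \<in> G \<Longrightarrow> uqF * g \<in> uq.span G"
    and "\<And>g. g \<in> G \<Longrightarrow> uqK * g \<in> uq.span G"
  shows "left_ideal (uq.span G)"
proof -
  have K: "uqK * x \<in> uq.span G" if "x \<in> uq.span G" for x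
    using span_mult_closed[OF assms(3) that] .
  then have Kn: "uqK ^ n * x \<in> uq.span G" if "x \<in> uq.span G" for x n
    using that by (induction n) (simp_all add: mult.assoc)
  \<comment> \<open>K^(2p) = 1 makes the inverse a power of K, so stability under K is
    enough.\<close>
  have Kinv: "uqKinv = (uqK ^ (2 * CARD('p) - 1) :: 'p uqsl2)"
  proof -
    have "uqKinv = uqKinv * (uqK ^ Suc (2 * CARD('p) - 1) :: 'p uqsl2)"
      by (simp add: uqK_power)
    also have "\<dots> = uqK ^ (2 * CARD('p) - 1)"
      by (simp only: power_Suc mult.assoc[symmetric] uqKinv_K mult_1)
    finally show ?thesis .
  qed
  have "\<forall>x\<in>uq.span G. u * x \<in> uq.span G" for u
  proof (induction u rule: uq_induct)
    case E
    then show ?case using span_mult_closed[OF assms(1)] by blast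
  next
    case F
    then show ?case using span_mult_closed[OF assms(2)] by blast
  next
    case (scalar c)
    then show ?case by (simp add: uq_scale_def[symmetric] uq.span_scale)
  qed (simp_all add: K Kn Kinv distrib_right uq.span_add mult.assoc)
  then show ?thesis
    by (simp add: left_ideal_def uq.span_zero uq.span_add)
qed

lemma weight_mult_casimir_shift:
  assumes "CARD('p::finite) \<ge> 2" "weight w x"
  shows "weight w (casimir_shift z * x :: 'p uqsl2)"
  using assms(2)
  by (simp add: weight_def casimir_shift_left_commute[OF assms(1)] casimir_shift_scale)

text \<open>On a weight vector y, E F and F E act as Casimir shifts, which differ from
  \<open>casimir_shift z\<close> by a scalar; so they produce only y and
  \<open>casimir_shift z * y\<close>, and this shift sends b to a and a to 0. The other hypotheses
  bound the powers that occur. The choice a = 0, s = 0, r = 0 covers \<open>X_ideal\<close>.\<close>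

lemma left_ideal_weight_span:
  fixes b :: "'p::finite uqsl2"
  assumes card: "CARD('p) \<ge> 2" and b: "weight w b" and w: "w \<noteq> 0"
    and Cb: "casimir_shift z * b = a" and Ca: "casimir_shift z * a = 0"
    and Ea: "uqE * a = 0" and Fa: "uqF ^ s * a = 0" and Eb: "uqE ^ Suc r * b = 0"
  shows "left_ideal (uq.span ({uqF ^ n * b | n. n < CARD('p)} \<union> {uqF ^ n * a | n. n < s} \<union>
    {uqE ^ i * b | i. 1 \<le> i \<and> i \<le> r}))"
    (is "left_ideal (uq.span ?G)")
proof (rule left_ideal_span)
  have a: "weight w a"
    unfolding Cb[symmetric] by (rule weight_mult_casimir_shift[OF card b])
  have Fb_mem: "uqF ^ n * b \<in> uq.span ?G" for n
  proof (cases "n < CARD('p)")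
    case True
    then show ?thesis by (intro uq.span_base) auto
  next
    case False
    then have "uqF ^ n = (uqF ^ (n - CARD('p)) * uqF ^ CARD('p) :: 'p uqsl2)"
      by (simp flip: power_add)
    then show ?thesis by (simp add: uqF_power uq.span_zero)
  qed
  have Fa_mem: "uqF ^ n * a \<in> uq.span ?G" for n
  proof (cases "n < s")
    case True
    then show ?thesis by (intro uq.span_base) auto
  next
    case False
    then have "uqF ^ n = (uqF ^ (n - s) * uqF ^ s :: 'p uqsl2)"
      by (simp flip: power_add)
    then show ?thesis by (simp add: Fa mult.assoc uq.span_zero)
  qed
  have Eb_mem: "uqE ^ n * b \<in> uq.span ?G" for n
  proof (cases "n \<le> r")
    case True
    then show ?thesis
      using Fb_mem[of 0] by (cases "n = 0") (auto intro!: uq.span_base)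
  next
    case False
    then have "uqE ^ n = (uqE ^ (n - Suc r) * uqE ^ Suc r :: 'p uqsl2)"
      by (simp flip: power_add del: power_Suc)
    then show ?thesis by (simp add: Eb mult.assoc uq.span_zero del: power_Suc)
  qed
  have EF: "uqE * (uqF ^ Suc n * y) \<in> uq.span ?G"
    if "weight w y" "uqF ^ n * y \<in> uq.span ?G" "uqF ^ n * (casimir_shift z * y) \<in> uq.span ?G" for n y
  proof -
    have "uqE * (uqF ^ Suc n * y) = casimir_shift (w * qroot CARD('p) powi (- 2 * int n) *
        inverse (qroot CARD('p))) * (uqF ^ n * y)"
      using E_F_weight[OF card weight_F_power[OF that(1)]] w by (simp add: mult.assoc)
    then show ?thesis
      using that(2,3) by (subst (asm) casimir_shift_change[where z = z])
        (simp add: casimir_shift_left_commute[OF card, symmetric] uq.span_add uq.span_scale)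
  qed
  have FE: "uqF * (uqE ^ Suc n * b) \<in> uq.span ?G" for n
  proof -
    have "uqE ^ n * a \<in> uq.span ?G"
      using Ea Fa_mem[of 0] by (cases n) (simp_all add: power_Suc2 mult.assoc uq.span_zero del: power_Suc)
    moreover have eq: "uqF * (uqE ^ Suc n * b) = casimir_shift (w * qroot CARD('p) powi (2 * int n) *
        qroot CARD('p)) * (uqE ^ n * b)"
      using F_E_weight[OF weight_E_power[OF b]] w by (simp add: mult.assoc)
    ultimately show ?thesis
      using Eb_mem[of n] unfolding eq by (subst casimir_shift_change[where z = z])
        (simp add: casimir_shift_left_commute[OF card, symmetric] Cb uq.span_add uq.span_scale)
  qed
  have EFb: "uqE * (uqF ^ n * b) \<in> uq.span ?G" for n
  proof (cases n)
    case 0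
    then show ?thesis using Eb_mem[of 1] by simp
  next
    case (Suc m)
    show ?thesis unfolding Suc by (rule EF[OF b Fb_mem]) (simp only: Cb Fa_mem)
  qed
  have EFa: "uqE * (uqF ^ n * a) \<in> uq.span ?G" for n
  proof (cases n)
    case 0
    then show ?thesis by (simp add: Ea uq.span_zero)
  next
    case (Suc m)
    show ?thesis unfolding Suc by (rule EF[OF a Fa_mem]) (simp only: Ca mult_zero_right uq.span_zero)
  qed
  fix g
  assume g: "g \<in> ?G"
  then consider n where "g = uqF ^ n * b" | n where "g = uqF ^ n * a"
    | n where "g = uqE ^ Suc n * b"
    by (auto dest: Suc_le_D)
  note cases = this
  show "uqE * g \<in> uq.span ?G"
    using cases
  proof cases
    case (3 n)
    then show ?thesis using Eb_mem[of "Suc (Suc n)"] by (simp add: mult.assoc)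
  qed (simp_all only: EFb EFa)
  show "uqF * g \<in> uq.span ?G"
    using cases
  proof cases
    case (1 n)
    then show ?thesis using Fb_mem[of "Suc n"] by (simp add: mult.assoc)
  next
    case (2 n)
    then show ?thesis using Fa_mem[of "Suc n"] by (simp add: mult.assoc)
  next
    case (3 n)
    then show ?thesis using FE by simp
  qed
  show "uqK * g \<in> uq.span ?G"
  proof -
    obtain c where "weight c g"
      using cases weight_F_power[OF b] weight_F_power[OF a] weight_E_power[OF b] by cases blast+
    then show ?thesis using g by (simp add: weight_def uq.span_scale uq.span_base)
  qed
qed

section \<open>Projections onto the eigenspaces of \<open>K\<close>\<close>

text \<open>For w a 2p-th root of unity this is 2p times the projector onto the w-eigenspace of K;
  \<open>uq_v\<close> is the case where w is \<open>weight_param\<close>.\<close>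

definition K_proj :: "complex \<Rightarrow> 'p::finite uqsl2" where
  "K_proj w = (\<Sum>l<2 * CARD('p). uq_scale (inverse w ^ l) (uqK ^ l))"

text \<open>Multiplication by K / w shifts the summation index by one, and the ends agree since
  K^(2p) = 1 = w^(2p).\<close>

lemma K_proj_eigen:
  fixes w :: complex
  assumes "w ^ (2 * CARD('p::finite)) = 1"
  shows weight_K_proj: "weight w (K_proj w :: 'p uqsl2)"
    and K_proj_mult_K: "K_proj w * uqK = (uq_scale w (K_proj w) :: 'p uqsl2)"
proof -
  let ?f = "\<lambda>l. uq_scale (inverse w ^ l) (uqK ^ l) :: 'p uqsl2"
  have w: "w \<noteq> 0" using assms by (auto simp: power_0_left)
  have "uq_scale (inverse w) (uqK * K_proj w) = (\<Sum>l<2 * CARD('p). ?f (Suc l))"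
    by (simp add: K_proj_def sum_distrib_left uq.scale_sum_right uq_scale_mult_right)
  also have "\<dots> = (\<Sum>l<2 * CARD('p). ?f l)"
  proof -
    have "(\<Sum>l<2 * CARD('p). ?f (Suc l)) - (\<Sum>l<2 * CARD('p). ?f l) = ?f (2 * CARD('p)) - ?f 0"
      using sum_lessThan_telescope[of ?f "2 * CARD('p)"] by (simp only: sum_subtractf)
    also have "\<dots> = 0"
      using assms by (simp only: uqK_power power_inverse) simp
    finally show ?thesis by simp
  qed
  finally have "uq_scale w (uq_scale (inverse w) (uqK * K_proj w)) = uq_scale w (K_proj w :: 'p uqsl2)"
    by (simp add: K_proj_def)
  then have *: "uqK * K_proj w = (uq_scale w (K_proj w) :: 'p uqsl2)"
    using w by simp
  then show "weight w (K_proj w :: 'p uqsl2)" by (simp add: weight_def)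
  have "K_proj w * uqK = (uqK * K_proj w :: 'p uqsl2)"
    by (simp add: K_proj_def sum_distrib_left sum_distrib_right uq_scale_mult_left
        uq_scale_mult_right power_commutes)
  then show "K_proj w * uqK = (uq_scale w (K_proj w) :: 'p uqsl2)" using * by simp
qed

text \<open>After exchanging the sums only the power K^0 survives. Dividing by 2p exhibits 1 as a
  combination of weight vectors.\<close>

lemma sum_K_proj:
  "(\<Sum>j<2 * CARD('p). K_proj (qroot CARD('p) powi int j)) =
    (uq_scale (of_nat (2 * CARD('p))) 1 :: 'p::finite uqsl2)"
proof -
  let ?N = "2 * CARD('p)"
  have "(\<Sum>j<?N. K_proj (qroot CARD('p) powi int j) :: 'p uqsl2) =
      (\<Sum>l<?N. \<Sum>j<?N. uq_scale (inverse (qroot CARD('p) powi int j) ^ l) (uqK ^ l))"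
    unfolding K_proj_def by (rule sum.swap)
  also have "\<dots> = (\<Sum>l<?N. uq_scale (\<Sum>j<?N. inverse (qroot CARD('p) powi int j) ^ l) (uqK ^ l))"
    by (simp only: uq.scale_sum_left)
  also have "\<dots> = (\<Sum>l<?N. if l = 0 then uq_scale (of_nat ?N) 1 else 0)"
  proof (rule sum.cong)
    fix l assume "l \<in> {..<?N}"
    then show "uq_scale (\<Sum>j<?N. inverse (qroot CARD('p) powi int j) ^ l) (uqK ^ l) =
        (if l = 0 then uq_scale (of_nat ?N) 1 else 0 :: 'p uqsl2)"
      using sum_qroot_power[of l "CARD('p)"] by (cases "l = 0") simp_all
  qed simp
  finally show ?thesis by simp
qed

section \<open>The generators of the summands\<close>

abbreviation weight_param :: "'p::finite itself \<Rightarrow> complex \<Rightarrow> nat \<Rightarrow> nat \<Rightarrow> complex" where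
  "weight_param _ \<alpha> s t \<equiv> \<alpha> * qroot CARD('p) powi (int s - 2 * int t + 1)"

lemma uq_v_eq_K_proj:
  assumes "\<alpha> \<in> {1, -1}"
  shows "(uq_v \<alpha> s t :: 'p::finite uqsl2) = K_proj (weight_param TYPE('p) \<alpha> s t)"
proof -
  have "inverse (weight_param TYPE('p) \<alpha> s t) = \<alpha> * qroot CARD('p) powi (- (int s - 2 * int t + 1))"
    using assms by (auto simp only: power_int_minus inverse_mult_distrib) auto
  moreover have "{0..2 * CARD('p) - 1} = {..<2 * CARD('p)}"
    using zero_less_card_finite[where 'a='p] by (cases "CARD('p)") auto
  ultimately show ?thesis by (simp only: uq_v_def K_proj_def)
qed

lemma uq_v_eigen:
  assumes "\<alpha> \<in> {1, -1}"
  shows weight_uq_v: "weight (weight_param TYPE('p) \<alpha> s t) (uq_v \<alpha> s t :: 'p::finite uqsl2)"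
    and uq_v_mult_K: "uq_v \<alpha> s t * uqK = (uq_scale (weight_param TYPE('p) \<alpha> s t) (uq_v \<alpha> s t) :: 'p uqsl2)"
proof -
  have "(weight_param TYPE('p) \<alpha> s t) ^ (2 * CARD('p)) = 1"
    using assms qroot_powi_root_of_unity[of "CARD('p)"] by (auto simp: power_mult_distrib)
  then show "weight (weight_param TYPE('p) \<alpha> s t) (uq_v \<alpha> s t :: 'p uqsl2)"
    "uq_v \<alpha> s t * uqK = (uq_scale (weight_param TYPE('p) \<alpha> s t) (uq_v \<alpha> s t) :: 'p uqsl2)"
    unfolding uq_v_eq_K_proj[OF assms] by (rule weight_K_proj K_proj_mult_K)+
qed

lemma weight_E_F_power:
  assumes "weight (\<alpha> * qroot CARD('p) powi i) x"
    and "k = i + 2 * int m - 2 * int n"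
  shows "weight (\<alpha> * qroot CARD('p) powi k) (uqE ^ m * (uqF ^ n * x) :: 'p::finite uqsl2)"
proof -
  have "\<alpha> * qroot CARD('p) powi i * qroot CARD('p) powi (- 2 * int n) * qroot CARD('p) powi (2 * int m) =
      \<alpha> * qroot CARD('p) powi k"
    by (simp add: assms(2) power_int_add[symmetric] mult.assoc algebra_simps del: mult_minus_left)
  then show ?thesis
    using weight_E_power[OF weight_F_power[OF assms(1), of n], of m] by (simp only:)
qed

lemma casimir_shift_cong:
  "casimir_value CARD('p::finite) z = casimir_value CARD('p) w \<Longrightarrow>
    casimir_shift z = (casimir_shift w :: 'p uqsl2)"
  by (simp add: casimir_shift_def)

lemma shift_prod_inverse:
  "shift_prod (inverse w) (inverse r) n = (shift_prod w r n :: 'p::finite uqsl2)"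
proof (induction n)
  case (Suc n)
  have "casimir_shift (inverse w * inverse r ^ n) = (casimir_shift (w * r ^ n) :: 'p uqsl2)"
    by (rule casimir_shift_cong) (simp add: casimir_value_def power_inverse add.commute)
  then show ?case using Suc by simp
qed simp

section \<open>The vectors a_0 and b_0 of a single summand\<close>

context
  fixes \<alpha> :: complex and s t :: nat
  assumes card: "CARD('p::finite) \<ge> 2" and \<alpha>: "\<alpha> \<in> {1, -1}"
    and t: "1 \<le> t" and ts: "t \<le> s" and sp: "s \<le> CARD('p)"
begin

lemma weight_uq_a_0: "weight (\<alpha> * qroot CARD('p) powi (int s - 1)) (uq_a \<alpha> s t 0 :: 'p uqsl2)"
  using weight_E_F_power[OF weight_uq_v[OF \<alpha>], of "int s - 1" s t "CARD('p) - 1" "CARD('p) - t"]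
    card ts sp by (simp add: uq_a_def mult.assoc of_nat_diff)

lemma E_uq_a_0: "uqE * uq_a \<alpha> s t 0 = (0 :: 'p uqsl2)"
proof -
  have "uqE * uqE ^ (CARD('p) - 1) = (0 :: 'p uqsl2)"
    using card by (simp flip: power_Suc add: uqE_power)
  then show ?thesis by (simp add: uq_a_def flip: mult.assoc)
qed

lemma casimir_shift_uq_a_0:
  "casimir_shift (\<alpha> * qroot CARD('p) powi int s) * uq_a \<alpha> s t 0 = (0 :: 'p uqsl2)"
proof -
  have "\<alpha> * qroot CARD('p) powi (int s - 1) * qroot CARD('p) = \<alpha> * qroot CARD('p) powi int s"
    by (simp add: power_int_diff)
  then have "casimir_shift (\<alpha> * qroot CARD('p) powi int s) * uq_a \<alpha> s t 0 =
      uqF * (uqE * uq_a \<alpha> s t 0 :: 'p uqsl2)"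
    using F_E_weight[OF weight_uq_a_0] \<alpha> by auto
  then show ?thesis by (simp add: E_uq_a_0)
qed

text \<open>As \<open>q\<close> has order \<open>2p\<close>, on the weight \<open>\<alpha>q^(-s-1)\<close> of \<open>x = F^(s-t+1) v\<close> the shifts making up
  \<open>F^s E^s\<close> are those by which \<open>E^(p-1) F^(p-1)\<close> extends \<open>E^(p-1-s) F^(p-1-s)\<close>.
  Hence \<open>F^s E^(p-1) F^(p-t) v = E^(p-1) F^(p-1) x\<close>, which contains a power \<open>F^n\<close> with \<open>n \<ge> p\<close>.\<close>

lemma F_power_uq_a_0: "uqF ^ s * uq_a \<alpha> s t 0 = (0 :: 'p uqsl2)"
proof (cases "s = CARD('p)")
  case True
  then show ?thesis by (simp add: uqF_power)
next
  case False
  define q where "q = qroot CARD('p)"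
  define m where "m = CARD('p) - 1 - s"
  define w where "w = \<alpha> * q powi (- int s - 1)"
  define x where "x = (uqF ^ (s - t + 1) * uq_v \<alpha> s t :: 'p uqsl2)"
  have m: "CARD('p) - 1 = m + s" "CARD('p) - t = m + (s - t + 1)" "int m = int CARD('p) - 1 - int s"
    using False sp ts by (simp_all add: m_def)
  have w: "weight w x"
    using weight_E_F_power[OF weight_uq_v[OF \<alpha>], of "- int s - 1" s t 0 "s - t + 1"] ts
    by (simp add: x_def w_def q_def of_nat_diff)
  have w0: "w \<noteq> 0" using \<alpha> by (auto simp: w_def q_def)
  have y: "weight w (uqE ^ m * (uqF ^ m * x))"
    unfolding w_def q_def using w by (intro weight_E_F_power) (simp_all add: w_def q_def)
  have shifts: "shift_prod (w * q) (q ^ 2) s =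
      (shift_prod (w * inverse q * (inverse q ^ 2) ^ m) (inverse q ^ 2) s :: 'p uqsl2)"
  proof -
    have "inverse q * (inverse q ^ 2) ^ m = q powi (- 1 - 2 * int m)"
      by (simp add: power_int_diff power_int_minus power_int_mult field_simps q_def)
        (simp add: mult.commute flip: power_mult)
    \<comment> \<open>With m = p - 1 - s the two exponents differ by 2p.\<close>
    also have "\<dots> = q powi (2 * int s + 1)"
      unfolding q_def using card by (subst qroot_powi_eq_iff) (simp_all add: m(3))
    finally have "w * inverse q * (inverse q ^ 2) ^ m = \<alpha> * (q powi (- int s - 1) * q powi (2 * int s + 1))"
      by (simp add: w_def mult.assoc)
    also have "\<dots> = \<alpha> * q powi int s"
      by (subst power_int_add[symmetric]) (simp_all add: q_def)
    also have "\<dots> = inverse (w * q)"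
      using \<alpha> by (auto simp: w_def power_int_diff power_int_minus q_def)
    finally have "w * inverse q * (inverse q ^ 2) ^ m = inverse (w * q)" .
    then show ?thesis
      by (simp only: power_inverse shift_prod_inverse)
  qed
  have "uqF ^ s * uq_a \<alpha> s t 0 = uqF ^ s * (uqE ^ s * (uqE ^ m * (uqF ^ m * x)))"
  proof -
    have "uqE ^ (CARD('p) - 1) = uqE ^ s * (uqE ^ m :: 'p uqsl2)"
      by (simp only: m(1) add.commute[of m] power_add)
    moreover have "uqF ^ (CARD('p) - t) = uqF ^ m * (uqF ^ (s - t + 1) :: 'p uqsl2)"
      by (simp only: m(2) power_add)
    ultimately show ?thesis by (simp add: uq_a_def x_def mult.assoc)
  qed
  also have "\<dots> = shift_prod (w * q) (q ^ 2) s * (uqE ^ m * (uqF ^ m * x))"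
    unfolding q_def by (rule F_E_power_weight[OF card y w0])
  also have "\<dots> = shift_prod (w * inverse q) (inverse q ^ 2) (m + s) * x"
    unfolding shifts shift_prod_add E_F_power_weight[OF card w w0, folded q_def]
    by (simp only: mult.assoc)
  also have "\<dots> = uqE ^ (m + s) * (uqF ^ (m + s) * x)"
    unfolding q_def by (rule E_F_power_weight[OF card w w0, symmetric])
  also have "uqF ^ (m + s) * x = uqF ^ (s - t) * (uqF ^ CARD('p) * uq_v \<alpha> s t)"
  proof -
    have "m + s + (s - t + 1) = s - t + CARD('p)"
      using False sp by (simp add: m_def)
    then show ?thesis
      by (simp only: x_def mult.assoc[symmetric] power_add[symmetric])
  qed
  finally show ?thesis by (simp add: uqF_power)
qed

text \<open>The terms of b_0. The value at m = 0, outside the range of the sum, is a_0.\<close>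

definition b_term :: "nat \<Rightarrow> 'p uqsl2" where
  "b_term m = uqE ^ (CARD('p) - m - 1) * (uqF ^ (CARD('p) - t - m) * uq_v \<alpha> s t)"

lemma uq_b_0_eq: "uq_b \<alpha> s t 0 = (\<Sum>m=1..CARD('p) - s. uq_scale (uq_mu CARD('p) \<alpha> s m) (b_term m))"
  by (simp add: uq_b_def b_term_def mult.assoc)

lemma weight_uq_b_0:
  assumes "s < CARD('p)"
  shows "weight (\<alpha> * qroot CARD('p) powi (int s - 1)) (uq_b \<alpha> s t 0 :: 'p uqsl2)"
  unfolding uq_b_0_eq
proof (intro weight_sum weight_scale)
  fix m assume "m \<in> {1..CARD('p) - s}"
  then have "m + 1 \<le> CARD('p)" "t + m \<le> CARD('p)" using t ts by auto
  then show "weight (\<alpha> * qroot CARD('p) powi (int s - 1)) (b_term m)"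
    using weight_E_F_power[OF weight_uq_v[OF \<alpha>], of "int s - 1" s t "CARD('p) - m - 1" "CARD('p) - t - m"]
    by (simp add: b_term_def of_nat_diff)
qed

text \<open>With y = F^(p-t-m) v, the terms at m and m - 1 are E^(p-m-1) y and E^(p-m-1) E F y. On y
  the product E F is a Casimir shift; exchanging it for the wanted one costs a product of brackets,
  rewritten by [p - m] = [m] and [-n] = -[n].\<close>

lemma casimir_shift_b_term:
  assumes "1 \<le> m" "m \<le> CARD('p) - s"
  shows "casimir_shift (\<alpha> * qroot CARD('p) powi int s) * b_term m =
    b_term (m - 1) + uq_scale (\<alpha> * qint CARD('p) m * qint CARD('p) (CARD('p) - s - m)) (b_term m)"
proof -
  define p where "p = CARD('p)"
  define y where "y = (uqF ^ (p - t - m) * uq_v \<alpha> s t :: 'p uqsl2)"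
  have mp: "m \<le> p - s" "s \<le> p" "p \<ge> 2" using assms card sp by (simp_all add: p_def)
  have "weight (\<alpha> * qroot p powi (int s - 2 * int (p - m) + 1)) y"
    using weight_E_F_power[OF weight_uq_v[OF \<alpha>], of "int s - 2 * int (p - m) + 1" s t 0 "p - t - m"]
      mp ts by (simp add: y_def p_def of_nat_diff)
  then have "uqE * (uqF * y) =
      casimir_shift (\<alpha> * qroot p powi (int s - 2 * int (p - m) + 1) * inverse (qroot p)) * y"
    unfolding p_def by (rule E_F_weight[OF card]) (use \<alpha> in auto)
  also have "\<alpha> * qroot p powi (int s - 2 * int (p - m) + 1) * inverse (qroot p) =
      \<alpha> * qroot p powi (int s - 2 * int (p - m))"
    by (simp add: power_int_add)
  also have "casimir_shift (\<alpha> * qroot p powi (int s - 2 * int (p - m))) * y =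
      casimir_shift (\<alpha> * qroot p powi int s) * y +
      uq_scale (\<alpha> * qbracket p (int (p - m)) * qbracket p (int s - int (p - m))) y"
    unfolding casimir_value_diff[OF \<alpha>, symmetric] p_def by (rule casimir_shift_change)
  also have "\<alpha> * qbracket p (int (p - m)) * qbracket p (int s - int (p - m)) =
      - (\<alpha> * qint p m * qint p (p - s - m))"
  proof -
    have "qbracket p (int (p - m)) = qint p m"
      using mp qbracket_diff_p[of p "int m"] by (simp add: qint_eq_qbracket of_nat_diff)
    moreover have "qbracket p (int s - int (p - m)) = - qint p (p - s - m)"
      using mp by (simp add: qint_eq_qbracket qbracket_def of_nat_diff minus_divide_left algebra_simps)
    ultimately show ?thesis by simp
  qed
  finally have EF: "casimir_shift (\<alpha> * qroot p powi int s) * y =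
      uqE * (uqF * y) + uq_scale (\<alpha> * qint p m * qint p (p - s - m)) y"
    by (simp add: uq.scale_minus_left)
  have "b_term (m - 1) = uqE ^ (p - m - 1) * (uqE * (uqF * y))"
  proof -
    have "p - (m - 1) - 1 = Suc (p - m - 1)" "p - t - (m - 1) = Suc (p - t - m)"
      using mp assms t ts by simp_all
    then show ?thesis
      by (simp only: b_term_def y_def p_def[symmetric] power_Suc2[of uqE] power_Suc[of uqF] mult.assoc)
  qed
  moreover have "b_term m = uqE ^ (p - m - 1) * y"
    by (simp add: b_term_def y_def p_def)
  ultimately show ?thesis
    unfolding p_def[symmetric]
    by (simp only: casimir_shift_left_commute[OF card, symmetric] EF distrib_left uq_scale_mult_right)
qed

text \<open>The new factor is the one with j = p - s - m. This recursion makes the image of b_0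
  under the Casimir shift telescope.\<close>

lemma uq_mu_Suc:
  assumes "1 \<le> m" "m < CARD('p) - s"
  shows "uq_mu CARD('p) \<alpha> s (Suc m) =
    - (\<alpha> * qint CARD('p) m * qint CARD('p) (CARD('p) - s - m)) * uq_mu CARD('p) \<alpha> s m"
proof -
  let ?r = "CARD('p) - s"
  have "{?r - (Suc m - 1)..?r - 1} = insert (?r - m) {?r - (m - 1)..?r - 1}" "?r - (?r - m) = m"
    using assms by auto
  then show ?thesis using assms by (simp add: uq_mu_def)
qed

text \<open>In the partial sums neighbouring terms cancel, leaving \<open>b_term 0\<close>, which is
  a_0, and a boundary term. At n = p - s the coefficient of the boundary term contains [0].\<close>

lemma casimir_shift_uq_b_0:
  assumes "s < CARD('p)"
  shows "casimir_shift (\<alpha> * qroot CARD('p) powi int s) * uq_b \<alpha> s t 0 = (uq_a \<alpha> s t 0 :: 'p uqsl2)"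
proof -
  let ?D = "casimir_shift (\<alpha> * qroot CARD('p) powi int s) :: 'p uqsl2"
  let ?\<mu> = "uq_mu CARD('p) \<alpha> s"
  let ?c = "\<lambda>m. \<alpha> * qint CARD('p) m * qint CARD('p) (CARD('p) - s - m)"
  have "?D * (\<Sum>m=1..n. uq_scale (?\<mu> m) (b_term m)) = b_term 0 + uq_scale (?\<mu> n * ?c n) (b_term n)"
    if "1 \<le> n" "n \<le> CARD('p) - s" for n
    using that
  proof (induction n rule: dec_induct)
    case base
    have "?\<mu> 1 = 1" using assms by (simp add: uq_mu_def)
    then show ?case
      using casimir_shift_b_term[of 1] base by (simp add: mult.assoc)
  next
    case (step n)
    have "?D * (\<Sum>m=1..Suc n. uq_scale (?\<mu> m) (b_term m)) =
        b_term 0 + uq_scale (?\<mu> n * ?c n) (b_term n) + uq_scale (?\<mu> (Suc n)) (?D * b_term (Suc n))"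
      using step by (simp add: distrib_left casimir_shift_scale)
    also have "?\<mu> n * ?c n = - ?\<mu> (Suc n)"
      using uq_mu_Suc[of n] step by simp
    also have "?D * b_term (Suc n) = b_term n + uq_scale (?c (Suc n)) (b_term (Suc n))"
      using casimir_shift_b_term[of "Suc n"] step by simp
    finally show ?case
      by (simp add: uq.scale_right_distrib uq.scale_minus_left)
  qed
  from this[of "CARD('p) - s"] show ?thesis
    using assms by (simp add: uq_b_0_eq b_term_def uq_a_def qint_def mult.assoc)
qed

text \<open>In each term the exponents of E add up to 2p - s - m, which is at least p for m \<le> p
  - s.\<close>

lemma E_power_uq_b_0: "uqE ^ Suc (CARD('p) - s) * uq_b \<alpha> s t 0 = (0 :: 'p uqsl2)"
proof -
  have "uqE ^ Suc (CARD('p) - s) * b_term m = 0" if "m \<in> {1..CARD('p) - s}" for m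
  proof -
    have "Suc (CARD('p) - s) + (CARD('p) - m - 1) = (CARD('p) - s - m) + CARD('p)"
      using that t ts by auto
    then have "uqE ^ Suc (CARD('p) - s) * uqE ^ (CARD('p) - m - 1) =
        uqE ^ (CARD('p) - s - m) * (uqE ^ CARD('p) :: 'p uqsl2)"
      by (simp only: power_add[symmetric])
    then show ?thesis by (simp add: b_term_def uqE_power flip: mult.assoc)
  qed
  then show ?thesis
    by (simp add: uq_b_0_eq sum_distrib_left uq_scale_mult_right del: power_Suc)
qed

end

section \<open>Recovering the weight vector modulo a Casimir shift\<close>

text \<open>The condition that lets a factor be cancelled: a left ideal containing x and P (C - r)
  v, with P central, also contains P v.\<close>

definition recoverable :: "complex \<Rightarrow> nat \<Rightarrow> nat \<Rightarrow> 'p::finite uqsl2 \<Rightarrow> bool" where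
  "recoverable \<alpha> s t x \<longleftrightarrow> (\<exists>u c h. c \<noteq> 0 \<and> u * x = uq_scale c (uq_v \<alpha> s t) +
    h * (casimir_shift (\<alpha> * qroot CARD('p) powi int s) * uq_v \<alpha> s t))"

text \<open>The case s = p stands for \<open>X_ideal\<close>, so that a sign and a pair 1 \<le> t
  \<le> s \<le> p index all summands uniformly.\<close>

definition block_ideal :: "complex \<Rightarrow> nat \<Rightarrow> nat \<Rightarrow> 'p::finite uqsl2 set" where
  "block_ideal \<alpha> s t = (if s < CARD('p) then P_ideal \<alpha> s t else X_ideal \<alpha> t)"

definition block_top :: "complex \<Rightarrow> nat \<Rightarrow> nat \<Rightarrow> 'p::finite uqsl2" where
  "block_top \<alpha> s t = (if s < CARD('p) then uq_b \<alpha> s t 0 else uq_a \<alpha> s t 0)"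

text \<open>Modulo \<open>casimir_shift z\<close> the Casimir element is a scalar, so each factor
  reduces to a difference of Casimir values.\<close>

lemma shift_prod_mod:
  "\<exists>h. shift_prod w r n =
    uq_scalar (\<Prod>k<n. casimir_value CARD('p) z - casimir_value CARD('p) (w * r ^ k)) +
    h * (casimir_shift z :: 'p::finite uqsl2)"
proof (induction n)
  case 0
  show ?case by (intro exI[of _ 0]) (simp add: uq_scalar_1)
next
  case (Suc n)
  define D where "D = (casimir_shift z :: 'p uqsl2)"
  define d where "d = casimir_value CARD('p) z - casimir_value CARD('p) (w * r ^ n)"
  define c where "c = (\<Prod>k<n. casimir_value CARD('p) z - casimir_value CARD('p) (w * r ^ k))"
  obtain h where h: "shift_prod w r n = uq_scalar c + h * D"
    using Suc unfolding c_def D_def by blast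
  have "casimir_shift (w * r ^ n) = D + uq_scalar d"
    using casimir_shift_change[of "w * r ^ n" 1 z] by (simp add: D_def d_def uq_scale_def)
  then have "shift_prod w r (Suc n) = D * uq_scalar c + uq_scalar d * uq_scalar c + (D + uq_scalar d) * h * D"
    by (simp add: h distrib_left distrib_right mult.assoc)
  also have "D * uq_scalar c = uq_scalar c * D"
    by (rule uq_scalar_commute[symmetric])
  also have "uq_scalar d * uq_scalar c = uq_scalar (c * d)"
    by (simp add: mult.commute flip: uq_scalar_mult)
  finally have "shift_prod w r (Suc n) = uq_scalar (c * d) + (uq_scalar c + (D + uq_scalar d) * h) * D"
    by (simp add: distrib_right)
  then show ?case by (auto simp: c_def d_def D_def)
qed

section \<open>The coefficient with which v is recovered\<close>

context
  fixes \<alpha> :: complex and s t :: nat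
  assumes card: "CARD('p::finite) \<ge> 2" and \<alpha>: "\<alpha> \<in> {1, -1}"
    and t: "1 \<le> t" and ts: "t \<le> s" and sp: "s \<le> CARD('p)"
begin

text \<open>The scalar by which F^(t-1) E^(t-1+n) F^n acts on v modulo C - r; the second product
  comes from E^n F^n, the first from F^(t-1) E^(t-1).\<close>

definition recover_coeff :: "nat \<Rightarrow> complex" where
  "recover_coeff n =
    (\<Prod>k<t - 1. \<alpha> * qbracket CARD('p) (int t - 1 - int k) * qbracket CARD('p) (int s - (int t - 1 - int k))) *
    (\<Prod>k<n. \<alpha> * qbracket CARD('p) (int t + int k) * qbracket CARD('p) (int s - (int t + int k)))"

text \<open>For n = s - t all brackets have arguments between 1 and s - 1, and [j] vanishes only at
  multiples of p.\<close>

lemma recover_coeff_nonzero: "recover_coeff (s - t) \<noteq> 0"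
  using \<alpha> t ts sp card by (auto simp: recover_coeff_def dest!: qbracket_eq_0D[OF _ card])

text \<open>The factor k = s - t contains [0]. Hence only the term m = p - s of b_0 helps to recover
  v.\<close>

lemma recover_coeff_eq_0:
  assumes "s - t < n"
  shows "recover_coeff n = 0"
proof -
  have "qbracket CARD('p) (int s - (int t + int (s - t))) = 0"
    using ts by (simp add: qbracket_def)
  then show ?thesis using assms unfolding recover_coeff_def by auto
qed

text \<open>E^n F^n v has the weight of v again, so first E^n F^n and then F^(t-1) E^(t-1) become
  shift products, each a scalar modulo the Casimir shift of the block.\<close>

lemma F_E_F_uq_v_mod:
  "\<exists>h. uqF ^ (t - 1) * (uqE ^ (t - 1 + n) * (uqF ^ n * uq_v \<alpha> s t)) =
    uq_scale (recover_coeff n) (uq_v \<alpha> s t) +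
    h * (casimir_shift (\<alpha> * qroot CARD('p) powi int s) * uq_v \<alpha> s t :: 'p uqsl2)"
proof -
  define q where "q = qroot CARD('p)"
  define w where "w = \<alpha> * q powi (int s - 2 * int t + 1)"
  define v where "v = (uq_v \<alpha> s t :: 'p uqsl2)"
  define D where "D = (casimir_shift (\<alpha> * q powi int s) :: 'p uqsl2)"
  have w0: "w \<noteq> 0" using \<alpha> by (auto simp: w_def q_def)
  have v: "weight w v" unfolding w_def v_def q_def by (rule weight_uq_v[OF \<alpha>])
  have EFv: "weight w (uqE ^ n * (uqF ^ n * v))"
    unfolding w_def q_def by (rule weight_E_F_power) (use v in \<open>simp_all add: w_def q_def\<close>)
  let ?P1 = "\<Prod>k<n. \<alpha> * qbracket CARD('p) (int t + int k) * qbracket CARD('p) (int s - (int t + int k))"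
  let ?P2 = "\<Prod>k<t - 1. \<alpha> * qbracket CARD('p) (int t - 1 - int k) *
    qbracket CARD('p) (int s - (int t - 1 - int k))"
  have P1: "?P1 = (\<Prod>k<n. casimir_value CARD('p) (\<alpha> * q powi int s) -
      casimir_value CARD('p) (w * inverse q * (inverse q ^ 2) ^ k))"
  proof (rule prod.cong)
    fix k
    have "w * inverse q * (inverse q ^ 2) ^ k = \<alpha> * (q powi (int s - 2 * int t + 1) * q powi (- 1 - 2 * int k))"
      by (simp add: w_def power_int_diff power_int_minus power_int_mult power_inverse q_def field_simps)
        (simp add: mult.commute flip: power_mult)
    also have "\<dots> = \<alpha> * q powi (int s - 2 * (int t + int k))"
      by (subst power_int_add[symmetric]) (simp_all add: q_def algebra_simps)
    finally show "\<alpha> * qbracket CARD('p) (int t + int k) * qbracket CARD('p) (int s - (int t + int k)) =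
        casimir_value CARD('p) (\<alpha> * q powi int s) - casimir_value CARD('p) (w * inverse q * (inverse q ^ 2) ^ k)"
      using casimir_value_diff[OF \<alpha>, of "CARD('p)" "int s" "int t + int k"] by (simp only: q_def)
  qed simp
  have P2: "?P2 = (\<Prod>k<t - 1. casimir_value CARD('p) (\<alpha> * q powi int s) -
      casimir_value CARD('p) (w * q * (q ^ 2) ^ k))"
  proof (rule prod.cong)
    fix k
    have "w * q * (q ^ 2) ^ k = \<alpha> * (q powi (int s - 2 * int t + 1) * q powi (1 + 2 * int k))"
      by (simp add: w_def power_int_add power_int_mult q_def)
    also have "\<dots> = \<alpha> * q powi (int s - 2 * (int t - 1 - int k))"
      by (subst power_int_add[symmetric]) (simp_all add: q_def algebra_simps)
    finally show "\<alpha> * qbracket CARD('p) (int t - 1 - int k) * qbracket CARD('p) (int s - (int t - 1 - int k)) =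
        casimir_value CARD('p) (\<alpha> * q powi int s) - casimir_value CARD('p) (w * q * (q ^ 2) ^ k)"
      using casimir_value_diff[OF \<alpha>, of "CARD('p)" "int s" "int t - 1 - int k"] by (simp only: q_def)
  qed simp
  obtain h1 where h1: "shift_prod (w * inverse q) (inverse q ^ 2) n = uq_scalar ?P1 + h1 * D"
    unfolding P1 D_def using shift_prod_mod by blast
  obtain h2 where h2: "shift_prod (w * q) (q ^ 2) (t - 1) = uq_scalar ?P2 + h2 * D"
    unfolding P2 D_def using shift_prod_mod by blast
  have "uqF ^ (t - 1) * (uqE ^ (t - 1 + n) * (uqF ^ n * v)) =
      uqF ^ (t - 1) * (uqE ^ (t - 1) * (uqE ^ n * (uqF ^ n * v)))"
    by (simp only: power_add mult.assoc)
  also have "\<dots> = (uq_scalar ?P2 + h2 * D) * ((uq_scalar ?P1 + h1 * D) * v)"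
    using F_E_power_weight[OF card EFv w0, of "t - 1"] E_F_power_weight[OF card v w0, of n]
    by (simp only: q_def[symmetric] h1 h2)
  also have "\<dots> = uq_scale (?P2 * ?P1) v + (h2 * (uq_scalar ?P1 + h1 * D) + uq_scalar ?P2 * h1) * (D * v)"
  proof -
    have "D * ((uq_scalar ?P1 + h1 * D) * v) = (uq_scalar ?P1 + h1 * D) * (D * v)"
      unfolding D_def by (rule casimir_shift_left_commute[OF card, symmetric])
    then have "(uq_scalar ?P2 + h2 * D) * ((uq_scalar ?P1 + h1 * D) * v) =
        uq_scalar ?P2 * (uq_scalar ?P1 * v + h1 * (D * v)) + h2 * ((uq_scalar ?P1 + h1 * D) * (D * v))"
      by (simp only: distrib_right mult.assoc)
    then show ?thesis
      by (simp only: distrib_left distrib_right mult.assoc uq_scale_def uq_scalar_mult add.assoc)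
        (simp only: add_ac)
  qed
  finally show ?thesis
    unfolding recover_coeff_def v_def D_def q_def by blast
qed

lemma recoverable_uq_a_0:
  assumes "s = CARD('p)"
  shows "recoverable \<alpha> s t (uq_a \<alpha> s t 0 :: 'p uqsl2)"
proof -
  have "t - 1 + (CARD('p) - t) = CARD('p) - 1" using assms t ts by simp
  then have "uqF ^ (t - 1) * (uqE ^ (t - 1 + (s - t)) * (uqF ^ (s - t) * uq_v \<alpha> s t)) =
      uqF ^ (t - 1) * (uq_a \<alpha> s t 0 :: 'p uqsl2)"
    by (simp add: uq_a_def assms mult.assoc)
  then show ?thesis
    unfolding recoverable_def using F_E_F_uq_v_mod[of "s - t"] recover_coeff_nonzero by metis
qed

text \<open>Left multiplication by F^(t-1) returns every term to the weight of v, since p - m - 1 =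
  (t - 1) + (p - t - m). All coefficients but that of m = p - s vanish.\<close>

lemma recoverable_uq_b_0:
  assumes "s < CARD('p)"
  shows "recoverable \<alpha> s t (uq_b \<alpha> s t 0 :: 'p uqsl2)"
proof -
  define v where "v = (uq_v \<alpha> s t :: 'p uqsl2)"
  define D where "D = (casimir_shift (\<alpha> * qroot CARD('p) powi int s) :: 'p uqsl2)"
  let ?r = "CARD('p) - s" and ?\<mu> = "uq_mu CARD('p) \<alpha> s"
  obtain h where h: "\<And>n. uqF ^ (t - 1) * (uqE ^ (t - 1 + n) * (uqF ^ n * v)) =
      uq_scale (recover_coeff n) v + h n * (D * v)"
    using F_E_F_uq_v_mod unfolding v_def D_def by metis
  let ?n = "\<lambda>m. CARD('p) - t - m"
  have "uqF ^ (t - 1) * uq_b \<alpha> s t 0 =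
      (\<Sum>m=1..?r. uq_scale (?\<mu> m) (uq_scale (recover_coeff (?n m)) v + h (?n m) * (D * v)))"
    unfolding uq_b_def sum_distrib_left power_0 mult_1 uq_scale_mult_right
  proof (intro sum.cong refl)
    fix m assume "m \<in> {1..?r}"
    then have "t - 1 + ?n m = CARD('p) - m - 1" using t ts by auto
    then have "uqF ^ (t - 1) * (uqE ^ (CARD('p) - m - 1) * uqF ^ ?n m * v) =
        uq_scale (recover_coeff (?n m)) v + h (?n m) * (D * v)"
      using h[of "?n m"] by (simp add: mult.assoc)
    then show "uq_scale (?\<mu> m) (uqF ^ (t - 1) * (uqE ^ (CARD('p) - m - 1) * uqF ^ ?n m * uq_v \<alpha> s t)) =
        uq_scale (?\<mu> m) (uq_scale (recover_coeff (?n m)) v + h (?n m) * (D * v))"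
      by (simp only: v_def)
  qed
  also have "\<dots> = uq_scale (\<Sum>m=1..?r. ?\<mu> m * recover_coeff (?n m)) v +
      (\<Sum>m=1..?r. uq_scale (?\<mu> m) (h (?n m))) * (D * v)"
    by (simp add: uq.scale_right_distrib sum.distrib uq.scale_sum_left sum_distrib_right uq_scale_mult_left)
  also have "(\<Sum>m=1..?r. ?\<mu> m * recover_coeff (?n m)) = (\<Sum>m=1..?r. if m = ?r then ?\<mu> ?r * recover_coeff (s - t) else 0)"
  proof (intro sum.cong refl)
    fix m assume m: "m \<in> {1..?r}"
    show "?\<mu> m * recover_coeff (?n m) = (if m = ?r then ?\<mu> ?r * recover_coeff (s - t) else 0)"
    proof (cases "m = ?r")
      case True
      then have "?n m = s - t" using sp ts by simp
      then show ?thesis using True by simp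
    next
      case False
      then have "s - t < ?n m" using m sp ts by auto
      then show ?thesis using False recover_coeff_eq_0 by simp
    qed
  qed
  also have "\<dots> = ?\<mu> ?r * recover_coeff (s - t)"
    using assms by (simp add: Suc_le_eq)
  finally have eq: "uqF ^ (t - 1) * uq_b \<alpha> s t 0 = uq_scale (?\<mu> ?r * recover_coeff (s - t)) v +
      (\<Sum>m=1..?r. uq_scale (?\<mu> m) (h (?n m))) * (D * v)" .
  have "?\<mu> ?r \<noteq> 0"
    using assms \<alpha> card t ts by (auto simp: uq_mu_def qint_eq_qbracket dest!: qbracket_eq_0D[OF _ card])
  then have "?\<mu> ?r * recover_coeff (s - t) \<noteq> 0"
    using recover_coeff_nonzero by simp
  with eq show ?thesis
    unfolding recoverable_def v_def D_def by blast
qed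

section \<open>The summands are left ideals\<close>

text \<open>In \<open>uq_x\<close> each exponent of E is one larger than in b_0, so the inner sum is
  E b_0.\<close>

lemma uq_x_eq:
  assumes "k \<le> CARD('p) - s - 1" "s < CARD('p)"
  shows "uq_x \<alpha> s t k =
    uq_scale (1 / (\<Prod>i=k + 1..CARD('p) - s - 1. - \<alpha> * qint CARD('p) i * qint CARD('p) (CARD('p) - s - i)))
      (uqE ^ (CARD('p) - s - k) * uq_b \<alpha> s t 0 :: 'p uqsl2)"
proof -
  have "(\<Sum>m=1..CARD('p) - s. uq_scale (uq_mu CARD('p) \<alpha> s m)
           (uqE ^ (CARD('p) - m) * uqF ^ (CARD('p) - t - m) * uq_v \<alpha> s t)) =
      uqE * (uq_b \<alpha> s t 0 :: 'p uqsl2)"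
    unfolding uq_b_def sum_distrib_left power_0 mult_1 uq_scale_mult_right
  proof (intro sum.cong refl)
    fix m assume "m \<in> {1..CARD('p) - s}"
    then have "CARD('p) - m = Suc (CARD('p) - m - 1)" using t ts by auto
    then have "uqE ^ (CARD('p) - m) = (uqE * uqE ^ (CARD('p) - m - 1) :: 'p uqsl2)"
      by (metis power_Suc)
    then show "uq_scale (uq_mu CARD('p) \<alpha> s m)
          (uqE ^ (CARD('p) - m) * uqF ^ (CARD('p) - t - m) * uq_v \<alpha> s t) =
        uq_scale (uq_mu CARD('p) \<alpha> s m)
          (uqE * (uqE ^ (CARD('p) - m - 1) * uqF ^ (CARD('p) - t - m) * uq_v \<alpha> s t) :: 'p uqsl2)"
      by (simp only: mult.assoc)
  qed
  moreover have "CARD('p) - s - k = Suc (CARD('p) - s - k - 1)" using assms by auto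
  then have "uqE ^ (CARD('p) - s - k) = uqE ^ (CARD('p) - s - k - 1) * (uqE :: 'p uqsl2)"
    by (metis power_Suc2)
  ultimately show ?thesis by (simp only: uq_x_def mult.assoc)
qed

text \<open>Puts the span into the shape of \<open>left_ideal_weight_span\<close>: y_k continues the
  powers of F on b_0 from n = s on, and x_k is a nonzero multiple of E^(p-s-k) b_0.\<close>

lemma P_ideal_eq:
  assumes "s < CARD('p)"
  shows "(P_ideal \<alpha> s t :: 'p uqsl2 set) = uq.span ({uqF ^ n * uq_b \<alpha> s t 0 | n. n < CARD('p)} \<union>
    {uqF ^ n * uq_a \<alpha> s t 0 | n. n < s} \<union>
    {uqE ^ i * uq_b \<alpha> s t 0 | i. 1 \<le> i \<and> i \<le> CARD('p) - s})"
    (is "_ = uq.span ?G")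
proof -
  let ?G' = "{uq_b \<alpha> s t n | n. n \<le> s - 1} \<union> {uq_a \<alpha> s t n | n. n \<le> s - 1} \<union>
     {uq_x \<alpha> s t k | k. k \<le> CARD('p) - s - 1} \<union> {uq_y \<alpha> s t k | k. k \<le> CARD('p) - s - 1} :: 'p uqsl2 set"
  have b: "uq_b \<alpha> s t n = uqF ^ n * (uq_b \<alpha> s t 0 :: 'p uqsl2)"
    and a: "uq_a \<alpha> s t n = uqF ^ n * (uq_a \<alpha> s t 0 :: 'p uqsl2)" for n
    by (simp_all add: uq_b_def uq_a_def mult.assoc)
  have "?G' \<subseteq> uq.span ?G"
  proof
    fix g assume "g \<in> ?G'"
    then consider n where "n \<le> s - 1" "g = uq_b \<alpha> s t n" | n where "n \<le> s - 1" "g = uq_a \<alpha> s t n"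
      | k where "k \<le> CARD('p) - s - 1" "g = uq_x \<alpha> s t k"
      | k where "k \<le> CARD('p) - s - 1" "g = uq_y \<alpha> s t k"
      by blast
    then show "g \<in> uq.span ?G"
    proof cases
      case (1 n)
      then have "n < CARD('p)" using assms t ts by simp
      then show ?thesis using 1(2) b[of n] by (auto intro!: uq.span_base)
    next
      case (2 n)
      then have "n < s" using t ts by simp
      then show ?thesis using 2(2) a[of n] by (auto intro!: uq.span_base)
    next
      case (3 k)
      then have "1 \<le> CARD('p) - s - k \<and> CARD('p) - s - k \<le> CARD('p) - s" using assms by auto
      then have "uqE ^ (CARD('p) - s - k) * uq_b \<alpha> s t 0 \<in> uq.span ?G"
        by (intro uq.span_base) blast
      then show ?thesis unfolding 3(2) uq_x_eq[OF 3(1) assms] by (rule uq.span_scale)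
    next
      case (4 k)
      then have "s + k < CARD('p)" using assms by simp
      then show ?thesis using 4(2) by (auto simp: uq_y_def intro!: uq.span_base)
    qed
  qed
  moreover have "?G \<subseteq> uq.span ?G'"
  proof
    fix g assume "g \<in> ?G"
    then consider n where "n < CARD('p)" "g = uqF ^ n * uq_b \<alpha> s t 0"
      | n where "n < s" "g = uqF ^ n * uq_a \<alpha> s t 0"
      | i where "1 \<le> i" "i \<le> CARD('p) - s" "g = uqE ^ i * uq_b \<alpha> s t 0"
      by blast
    then show "g \<in> uq.span ?G'"
    proof cases
      case (1 n)
      show ?thesis
      proof (cases "n \<le> s - 1")
        case True
        then show ?thesis using 1(2) b[of n] by (auto intro!: uq.span_base)
      next
        case False
        then have "g = uq_y \<alpha> s t (n - s)" "n - s \<le> CARD('p) - s - 1"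
          using 1 by (simp_all add: uq_y_def)
        then show ?thesis by (intro uq.span_base) blast
      qed
    next
      case (2 n)
      then have "n \<le> s - 1" by simp
      then show ?thesis using 2(2) a[of n] by (auto intro!: uq.span_base)
    next
      case (3 i)
      define k where "k = CARD('p) - s - i"
      define c where "c = (\<Prod>i=k + 1..CARD('p) - s - 1. - \<alpha> * qint CARD('p) i * qint CARD('p) (CARD('p) - s - i))"
      have k: "k \<le> CARD('p) - s - 1" "CARD('p) - s - k = i" using 3 by (auto simp: k_def)
      have "c \<noteq> 0"
        using assms \<alpha> card t ts by (auto simp: c_def qint_eq_qbracket dest!: qbracket_eq_0D[OF _ card])
      then have "g = uq_scale c (uq_x \<alpha> s t k)"
        by (simp only: 3(3) uq_x_eq[OF k(1) assms, folded c_def] k(2)) simp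
      moreover have "uq_x \<alpha> s t k \<in> uq.span ?G'"
        using k(1) by (intro uq.span_base) blast
      ultimately show ?thesis by (simp add: uq.span_scale)
    qed
  qed
  ultimately show ?thesis by (simp add: P_ideal_def uq.span_eq)
qed

end

section \<open>Properties common to both families of summands\<close>

context
  fixes \<alpha> :: complex and s t :: nat
  assumes card: "CARD('p::finite) \<ge> 2" and \<alpha>: "\<alpha> \<in> {1, -1}"
    and t: "1 \<le> t" and ts: "t \<le> s" and sp: "s \<le> CARD('p)"
begin

text \<open>The two empty families make the span an instance of
  \<open>left_ideal_weight_span\<close> with a = 0.\<close>

lemma X_ideal_eq:
  assumes "s = CARD('p)"
  shows "(X_ideal \<alpha> t :: 'p uqsl2 set) = uq.span ({uqF ^ n * uq_a \<alpha> s t 0 | n. n < CARD('p)} \<union>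
    {uqF ^ n * 0 | n. n < 0} \<union> {uqE ^ i * uq_a \<alpha> s t 0 | i. 1 \<le> i \<and> i \<le> 0})"
proof -
  have a: "uq_a \<alpha> s t n = uqF ^ n * (uq_a \<alpha> s t 0 :: 'p uqsl2)" for n
    by (simp add: uq_a_def mult.assoc)
  have "{uq_a \<alpha> s t n | n. n \<le> CARD('p) - 1} =
      {uqF ^ n * uq_a \<alpha> s t 0 :: 'p uqsl2 | n. n < CARD('p)}"
  proof (intro Collect_cong ex_cong1)
    fix x :: "'p uqsl2" and n
    have "n \<le> CARD('p) - 1 \<longleftrightarrow> n < CARD('p)" using card by auto
    then show "x = uq_a \<alpha> s t n \<and> n \<le> CARD('p) - 1 \<longleftrightarrow>
        x = uqF ^ n * uq_a \<alpha> s t 0 \<and> n < CARD('p)"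
      using a[of n] by (simp only:)
  qed
  moreover have "{uqF ^ n * 0 | n. n < 0} = ({} :: 'p uqsl2 set)"
    "{uqE ^ i * uq_a \<alpha> s t 0 | i. 1 \<le> i \<and> i \<le> 0} = ({} :: 'p uqsl2 set)"
    by auto
  ultimately show ?thesis
    unfolding X_ideal_def assms[symmetric] by (simp only: Un_empty_right)
qed

lemma left_ideal_block_ideal: "left_ideal (block_ideal \<alpha> s t :: 'p uqsl2 set)"
proof -
  have nz: "\<alpha> * qroot CARD('p) powi (int s - 1) \<noteq> 0" using \<alpha> by auto
  show ?thesis
  proof (cases "s < CARD('p)")
    case True
    have "left_ideal (P_ideal \<alpha> s t :: 'p uqsl2 set)"
      unfolding P_ideal_eq[OF card \<alpha> t ts sp True]
      by (rule left_ideal_weight_span[OF card weight_uq_b_0 nz casimir_shift_uq_b_0 casimir_shift_uq_a_0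
            E_uq_a_0 F_power_uq_a_0 E_power_uq_b_0]) (fact card \<alpha> t ts sp True)+
    then show ?thesis using True by (simp add: block_ideal_def)
  next
    case False
    then have s: "s = CARD('p)" using sp by simp
    have "left_ideal (X_ideal \<alpha> t :: 'p uqsl2 set)"
      unfolding X_ideal_eq[OF s]
      by (rule left_ideal_weight_span[OF card weight_uq_a_0 nz casimir_shift_uq_a_0])
        (use card \<alpha> t ts sp E_uq_a_0[OF card \<alpha> t ts sp] in simp_all)
    then show ?thesis using False by (simp add: block_ideal_def)
  qed
qed

lemma block_top_in_block_ideal: "block_top \<alpha> s t \<in> (block_ideal \<alpha> s t :: 'p uqsl2 set)"
proof (cases "s < CARD('p)")
  case True
  then show ?thesis
    by (auto simp: block_top_def block_ideal_def P_ideal_def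
        intro!: uq.span_base)
next
  case False
  then have "s = CARD('p)" using sp by simp
  then have "uq_a \<alpha> s t 0 \<in> (X_ideal \<alpha> t :: 'p uqsl2 set)"
    unfolding X_ideal_def by (intro uq.span_base) auto
  then show ?thesis
    using False by (simp add: block_top_def block_ideal_def)
qed

lemma recoverable_block_top: "recoverable \<alpha> s t (block_top \<alpha> s t :: 'p uqsl2)"
  using recoverable_uq_b_0[OF card \<alpha> t ts sp] recoverable_uq_a_0[OF card \<alpha> t ts sp] sp
  by (simp add: block_top_def)

text \<open>Every element is u times \<open>block_top\<close>, because a_0 is itself a multiple of
  b_0. Right multiplication by K and multiplication by a central element both commute with left
  multiplication by u, so only \<open>block_top\<close> has to be checked.\<close>

lemma block_ideal_eigen:
  assumes x: "x \<in> (block_ideal \<alpha> s t :: 'p uqsl2 set)"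
  defines "D \<equiv> casimir_shift (\<alpha> * qroot CARD('p) powi int s) :: 'p uqsl2"
  shows "x * uqK = uq_scale (weight_param TYPE('p) \<alpha> s t) x \<and> D * (D * x) = 0"
proof -
  let ?b = "block_top \<alpha> s t :: 'p uqsl2" and ?w = "weight_param TYPE('p) \<alpha> s t"
  have v: "(u * uq_v \<alpha> s t) * uqK = (uq_scale ?w (u * uq_v \<alpha> s t) :: 'p uqsl2)" for u
    by (simp add: mult.assoc uq_v_mult_K[OF \<alpha>] uq_scale_mult_right)
  have aK: "uq_a \<alpha> s t 0 * uqK = (uq_scale ?w (uq_a \<alpha> s t 0) :: 'p uqsl2)"
    unfolding uq_a_def by (rule v)
  have bK: "uq_b \<alpha> s t 0 * uqK = (uq_scale ?w (uq_b \<alpha> s t 0) :: 'p uqsl2)"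
    by (simp add: uq_b_def sum_distrib_right uq_scale_mult_left v uq.scale_sum_right mult.commute)
  have top: "?b * uqK = uq_scale ?w ?b"
    using aK bK by (simp add: block_top_def)
  have D: "D * (D * ?b) = 0"
  proof (cases "s < CARD('p)")
    case True
    then show ?thesis
      by (simp only: D_def block_top_def if_True
          casimir_shift_uq_b_0[OF card \<alpha> t ts sp True] casimir_shift_uq_a_0[OF card \<alpha> t ts sp])
  next
    case False
    then show ?thesis
      by (simp only: D_def block_top_def if_False
          casimir_shift_uq_a_0[OF card \<alpha> t ts sp] mult_zero_right)
  qed
  have "\<exists>u. x = u * ?b"
  proof -
    define G where "G = (if s < CARD('p) then
      {uqF ^ n * uq_b \<alpha> s t 0 | n. n < CARD('p)} \<union> {uqF ^ n * uq_a \<alpha> s t 0 | n. n < s} \<union>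
      {uqE ^ i * uq_b \<alpha> s t 0 | i. 1 \<le> i \<and> i \<le> CARD('p) - s}
      else {uqF ^ n * uq_a \<alpha> s t 0 | n. n < CARD('p)} :: 'p uqsl2 set)"
    have "block_ideal \<alpha> s t = uq.span G"
      using sp X_ideal_eq by (simp add: G_def block_ideal_def P_ideal_eq[OF card \<alpha> t ts sp])
    with x have "x \<in> uq.span G" by simp
    then show ?thesis
    proof (induction rule: uq.span_induct_alt)
      case base
      show ?case by (intro exI[of _ 0]) simp
    next
      case (step c g y)
      have "\<exists>u. uqF ^ n * uq_a \<alpha> s t 0 = u * ?b" for n
      proof (cases "s < CARD('p)")
        case True
        then have "uqF ^ n * uq_a \<alpha> s t 0 = uqF ^ n * D * ?b"
          by (simp only: D_def block_top_def if_True
              casimir_shift_uq_b_0[OF card \<alpha> t ts sp True] mult.assoc)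
        then show ?thesis by blast
      qed (auto simp: block_top_def)
      then obtain u where "g = u * ?b"
        using step(1) by (auto simp: G_def block_top_def split: if_splits)
      moreover obtain u' where "y = u' * ?b" using step by blast
      ultimately have "uq_scale c g + y = (uq_scale c u + u') * ?b"
        by (simp add: distrib_right uq_scale_mult_left)
      then show ?case by blast
    qed
  qed
  then obtain u where u: "x = u * ?b" by blast
  have "D * (D * x) = u * (D * (D * ?b))"
    unfolding u D_def by (simp only: casimir_shift_left_commute[OF card, of u, symmetric])
  then show ?thesis
    using top D by (simp add: u mult.assoc uq_scale_mult_right)
qed

end

section \<open>Internal direct sums\<close>

text \<open>Induction on the number of other components: T kills the component k and keeps the
  others in their sets, so the images T (f j) satisfy a shorter relation; the trivial kernel of T on
  L i then gives f i = 0.\<close>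

lemma sum_zero_of_separating:
  fixes L :: "'i \<Rightarrow> 'a::ab_group_add set"
  assumes "finite A" "i \<notin> A" "i \<in> I" "A \<subseteq> I"
    and sep: "\<And>k. k \<in> I \<Longrightarrow> k \<noteq> i \<Longrightarrow> \<exists>T. (\<forall>x y. T (x + y) = T x + T y) \<and>
      (\<forall>j\<in>I. \<forall>x\<in>L j. T x \<in> L j) \<and> (\<forall>x\<in>L k. T x = 0) \<and> (\<forall>x\<in>L i. T x = 0 \<longrightarrow> x = 0)"
    and "\<And>j. j \<in> I \<Longrightarrow> f j \<in> L j" "f i + sum f A = 0"
  shows "f i = 0"
  using assms(1,2,4,6,7)
proof (induction A arbitrary: f rule: finite_induct)
  case empty
  then show ?case by simp
next
  case (insert k A)
  have "k \<in> I" "k \<noteq> i" using insert.prems by auto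
  then obtain T where "\<forall>x y. T (x + y) = T x + T y" "\<forall>j\<in>I. \<forall>x\<in>L j. T x \<in> L j"
    "\<forall>x\<in>L k. T x = 0" "\<forall>x\<in>L i. T x = 0 \<longrightarrow> x = 0"
    using sep[of k] by blast
  then have T: "\<And>x y. T (x + y) = T x + T y" "\<And>j x. j \<in> I \<Longrightarrow> x \<in> L j \<Longrightarrow> T x \<in> L j"
    "\<And>x. x \<in> L k \<Longrightarrow> T x = 0" "\<And>x. x \<in> L i \<Longrightarrow> T x = 0 \<Longrightarrow> x = 0"
    by auto
  have T0: "T 0 = 0" using T(1)[of 0 0] by simp
  have Tsum: "T (sum f A) = (\<Sum>j\<in>A. T (f j))"
    using insert.hyps(1) by (induction A rule: finite_induct) (simp_all add: T0 T(1))
  have "T (f i + (f k + sum f A)) = 0"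
    using insert.prems(4) insert.hyps by (simp add: T0)
  moreover have "T (f k) = 0" using T(3) insert.prems by simp
  ultimately have "T (f i) + (\<Sum>j\<in>A. T (f j)) = 0"
    by (simp add: T(1) Tsum)
  then have "T (f i) = 0"
    using insert.IH[of "\<lambda>j. T (f j)"] insert.prems T(2) by simp
  then show ?case using T(4) insert.prems assms(3) by simp
qed

lemma left_ideal_sums:
  assumes "\<And>i. i \<in> I \<Longrightarrow> left_ideal (L i)"
  shows "left_ideal {\<Sum>i\<in>I. f i | f. f \<in> (\<Pi>\<^sub>E i\<in>I. L i)}" (is "left_ideal ?S")
proof -
  have mem: "(\<Sum>i\<in>I. f i) \<in> ?S" if "\<And>i. i \<in> I \<Longrightarrow> f i \<in> L i" for f
  proof -
    have "(\<Sum>i\<in>I. f i) = (\<Sum>i\<in>I. restrict f I i)" by simp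
    moreover have "restrict f I \<in> (\<Pi>\<^sub>E i\<in>I. L i)" using that by simp
    ultimately show ?thesis by blast
  qed
  show ?thesis
    unfolding left_ideal_def
  proof (intro conjI ballI allI)
    show "0 \<in> ?S" using mem[of "\<lambda>_. 0"] assms by (simp add: left_ideal_def)
  next
    fix x y assume "x \<in> ?S" "y \<in> ?S"
    then obtain f g where "x = (\<Sum>i\<in>I. f i)" "f \<in> (\<Pi>\<^sub>E i\<in>I. L i)" "y = (\<Sum>i\<in>I. g i)" "g \<in> (\<Pi>\<^sub>E i\<in>I. L i)"
      by blast
    then show "x + y \<in> ?S"
      using mem[of "\<lambda>i. f i + g i"] assms by (simp add: sum.distrib left_ideal_def PiE_iff)
  next
    fix a x assume "x \<in> ?S"
    then obtain f where "x = (\<Sum>i\<in>I. f i)" "f \<in> (\<Pi>\<^sub>E i\<in>I. L i)"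
      by blast
    then show "a * x \<in> ?S"
      using mem[of "\<lambda>i. a * f i"] assms by (simp add: sum_distrib_left left_ideal_def PiE_iff)
  qed
qed

lemma subset_left_ideal_sums:
  assumes "\<And>i. i \<in> I \<Longrightarrow> left_ideal (L i)" "finite I" "j \<in> I" "x \<in> L j"
  shows "x \<in> {\<Sum>i\<in>I. f i | f. f \<in> (\<Pi>\<^sub>E i\<in>I. L i)}"
proof -
  let ?f = "\<lambda>i\<in>I. if i = j then x else 0"
  have "?f \<in> (\<Pi>\<^sub>E i\<in>I. L i)" "(\<Sum>i\<in>I. ?f i) = x"
    using assms by (auto simp: left_ideal_def)
  then show ?thesis by (intro CollectI exI[of _ ?f]) simp
qed

text \<open>Existence: the sums form a left ideal containing all summands, hence 1, hence every x.
  Uniqueness: the difference of two decompositions is a relation to which the separating maps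
  apply.\<close>

lemma ring_direct_sum_of_left_ideals_separating:
  fixes L :: "'i \<Rightarrow> 'a::ring_1 set"
  assumes "finite I" and L: "\<And>i. i \<in> I \<Longrightarrow> left_ideal (L i)"
    and one: "\<And>S. left_ideal S \<Longrightarrow> (\<And>i. i \<in> I \<Longrightarrow> L i \<subseteq> S) \<Longrightarrow> 1 \<in> S"
    and sep: "\<And>i k. i \<in> I \<Longrightarrow> k \<in> I \<Longrightarrow> k \<noteq> i \<Longrightarrow> \<exists>T. (\<forall>x y. T (x + y) = T x + T y) \<and>
      (\<forall>j\<in>I. \<forall>x\<in>L j. T x \<in> L j) \<and> (\<forall>x\<in>L k. T x = 0) \<and> (\<forall>x\<in>L i. T x = 0 \<longrightarrow> x = 0)"
  shows "ring_direct_sum_of_left_ideals I L"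
  unfolding ring_direct_sum_of_left_ideals_def
proof (intro conjI ballI allI)
  fix x
  let ?S = "{\<Sum>i\<in>I. f i | f. f \<in> (\<Pi>\<^sub>E i\<in>I. L i)}"
  have S: "left_ideal ?S" using left_ideal_sums[OF L] .
  then have "1 \<in> ?S"
    using subset_left_ideal_sums[of I L, OF L assms(1)] by (intro one) blast+
  then have "x * 1 \<in> ?S" using S unfolding left_ideal_def by blast
  then obtain f where f: "f \<in> (\<Pi>\<^sub>E i\<in>I. L i)" "x = (\<Sum>i\<in>I. f i)" by auto
  show "\<exists>!f. f \<in> (\<Pi>\<^sub>E i\<in>I. L i) \<and> x = (\<Sum>i\<in>I. f i)"
  proof (rule ex1I[of _ f])
    fix g assume g: "g \<in> (\<Pi>\<^sub>E i\<in>I. L i) \<and> x = (\<Sum>i\<in>I. g i)"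
    show "g = f"
    proof (rule PiE_ext)
      fix i assume i: "i \<in> I"
      have "g i - f i = 0"
      proof (rule sum_zero_of_separating[of "I - {i}" i I L "\<lambda>j. g j - f j"])
        fix j assume j: "j \<in> I"
        then have "f j \<in> L j" "g j \<in> L j" using f g by auto
        then have "g j + (- 1) * f j \<in> L j" using L[OF j] unfolding left_ideal_def by blast
        then show "g j - f j \<in> L j" by simp
      next
        have "g i - f i + (\<Sum>j\<in>I - {i}. g j - f j) = (\<Sum>j\<in>I. g j - f j)"
          using sum.remove[OF assms(1) i, of "\<lambda>j. g j - f j"] by simp
        then show "g i - f i + (\<Sum>j\<in>I - {i}. g j - f j) = 0"
          using f g by (simp add: sum_subtractf)
      qed (use i sep assms(1) in auto)
      then show "g i = f i" by simp
    qed (use f g in auto)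
  qed (use f in auto)
qed (use assms in auto)

section \<open>The decomposition\<close>

text \<open>All p shifts together kill v, because their product acts as F^p E^p. The factors are
  then removed one at a time from the last, each by the summand whose Casimir value is its root,
  until v itself is left.\<close>

lemma K_proj_in_left_ideal:
  fixes S :: "'p::finite uqsl2 set"
  assumes card: "CARD('p) \<ge> 2" and S: "left_ideal S"
    and blocks: "\<And>\<alpha> s t. \<alpha> \<in> {1, -1} \<Longrightarrow> 1 \<le> t \<Longrightarrow> t \<le> s \<Longrightarrow> s \<le> CARD('p) \<Longrightarrow> block_ideal \<alpha> s t \<subseteq> S"
  shows "K_proj (qroot CARD('p) powi l) \<in> S"
proof -
  define q where "q = qroot CARD('p)"
  define v where "v = (K_proj (q powi l) :: 'p uqsl2)"
  have add: "x + y \<in> S" if "x \<in> S" "y \<in> S" for x y using S that by (simp add: left_ideal_def)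
  have mult: "u * x \<in> S" if "x \<in> S" for u x using S that by (simp add: left_ideal_def)
  have v: "weight (q powi l) v"
    unfolding v_def q_def by (rule weight_K_proj) (simp add: qroot_powi_root_of_unity)
  have strip: "shift_prod (q powi l * q) (q ^ 2) n * v \<in> S"
    if n: "n < CARD('p)" and step: "shift_prod (q powi l * q) (q ^ 2) (Suc n) * v \<in> S" for n
  proof -
    let ?P = "shift_prod (q powi l * q) (q ^ 2) n :: 'p uqsl2"
    obtain \<alpha> s t where st: "\<alpha> \<in> {1, -1}" "1 \<le> t" "t \<le> s" "s \<le> CARD('p)"
      and w: "\<alpha> * qroot CARD('p) powi (int s - 2 * int t + 1) = q powi l"
      and z: "casimir_value CARD('p) (q powi (l + 2 * int n + 1)) =
        casimir_value CARD('p) (\<alpha> * q powi int s)"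
      unfolding q_def by (rule casimir_root_index[OF card n])
    have "q powi l * q * (q ^ 2) ^ n = q powi (l + 2 * int n + 1)"
      by (simp add: q_def power_int_add power_int_mult)
    then have shift: "casimir_shift (q powi l * q * (q ^ 2) ^ n) = (casimir_shift (\<alpha> * q powi int s) :: 'p uqsl2)"
      using z casimir_shift_cong by metis
    have uv: "uq_v \<alpha> s t = v"
      by (simp only: uq_v_eq_K_proj[OF st(1)] w v_def)
    obtain u c h where c: "c \<noteq> 0"
      and u: "u * block_top \<alpha> s t = uq_scale c v + h * (casimir_shift (\<alpha> * q powi int s) * v)"
      using recoverable_block_top[OF card st] unfolding recoverable_def uv q_def by blast
    have "u * block_top \<alpha> s t \<in> S"
      using mult blocks[OF st] block_top_in_block_ideal[OF card st] by blast
    then have "?P * (uq_scale c v + h * (casimir_shift (\<alpha> * q powi int s) * v)) \<in> S"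
      unfolding u by (rule mult)
    also have "?P * (uq_scale c v + h * (casimir_shift (\<alpha> * q powi int s) * v)) =
        uq_scale c (?P * v) + h * (shift_prod (q powi l * q) (q ^ 2) (Suc n) * v)"
    proof -
      have "?P * (h * (casimir_shift (\<alpha> * q powi int s) * v)) =
          h * (casimir_shift (\<alpha> * q powi int s) * (?P * v))"
        by (metis mult.assoc shift_prod_central[OF card])
      then show ?thesis by (simp only: distrib_left uq_scale_mult_right shift_prod.simps shift) (simp only: mult.assoc)
    qed
    finally have "uq_scale c (?P * v) + h * (shift_prod (q powi l * q) (q ^ 2) (Suc n) * v) \<in> S" .
    from add[OF this mult[OF step, of "- h"]] have "uq_scale c (?P * v) \<in> S" by simp
    from mult[OF this, of "uq_scalar (inverse c)"] c show ?thesis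
      by (simp flip: uq_scale_def)
  qed
  have "shift_prod (q powi l * q) (q ^ 2) (CARD('p) - n) * v \<in> S" if "n \<le> CARD('p)" for n
    using that
  proof (induction n)
    case 0
    have "shift_prod (q powi l * q) (q ^ 2) CARD('p) * v = uqF ^ CARD('p) * (uqE ^ CARD('p) * v)"
      unfolding q_def by (rule F_E_power_weight[OF card v[unfolded q_def], symmetric]) simp
    then show ?case using S by (simp add: uqF_power left_ideal_def)
  next
    case (Suc n)
    then show ?case using strip[of "CARD('p) - Suc n"] by (simp add: Suc_diff_Suc)
  qed
  from this[of "CARD('p)"] show ?thesis by (simp add: v_def q_def)
qed

theorem mainTheorem4:
  assumes "CARD('p::finite) \<ge> 2"
  shows "ring_direct_sum_of_left_ideals
    ({P \<alpha> s t | \<alpha> s t. \<alpha> \<in> {1, -1} \<and> s \<in> {1..CARD('p) - 1} \<and> t \<in> {1..s}} \<union>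
     {X \<alpha> t | \<alpha> t. \<alpha> \<in> {1, -1} \<and> t \<in> {1..CARD('p)}})
    (summand_ideal :: summand \<Rightarrow> 'p uqsl2 set)"
    (is "ring_direct_sum_of_left_ideals ?I ?L")
proof (rule ring_direct_sum_of_left_ideals_separating)
  note card = assms
  have params: "\<exists>\<alpha> s t. \<alpha> \<in> {1, -1} \<and> 1 \<le> t \<and> t \<le> s \<and>
      s \<le> CARD('p) \<and> ?L i = block_ideal \<alpha> s t \<and> i = (if s < CARD('p) then P \<alpha> s t else X \<alpha> t)"
    if mem: "i \<in> ?I" for i
  proof -
    consider \<alpha> s t where "i = P \<alpha> s t" "\<alpha> \<in> {1, -1}" "s \<in> {1..CARD('p) - 1}" "t \<in> {1..s}"
      | \<alpha> t where "i = X \<alpha> t" "\<alpha> \<in> {1, -1}" "t \<in> {1..CARD('p)}"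
      using mem by blast
    then show ?thesis
    proof cases
      case (1 \<alpha> s t)
      then have "s < CARD('p)" using card by auto
      then show ?thesis using 1 block_ideal_def[of \<alpha> s t, where 'p='p] by auto
    next
      case (2 \<alpha> t)
      then show ?thesis using block_ideal_def[of \<alpha> "CARD('p)" t, where 'p='p] by auto
    qed
  qed
  have "?I \<subseteq> (\<lambda>(\<alpha>, s, t). P \<alpha> s t) ` ({1, -1} \<times> {1..CARD('p)} \<times> {1..CARD('p)}) \<union>
      (\<lambda>(\<alpha>, t). X \<alpha> t) ` ({1, -1} \<times> {1..CARD('p)})"
    by (auto simp: image_iff)
  then show "finite ?I" by (rule finite_subset) auto
  have ideal: "left_ideal (?L i)" if i: "i \<in> ?I" for i
    using params[OF i] left_ideal_block_ideal[OF card] by metis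
  then show "\<And>i. i \<in> ?I \<Longrightarrow> left_ideal (?L i)" .
  show "1 \<in> S" if S: "left_ideal S" and sub: "\<And>i. i \<in> ?I \<Longrightarrow> ?L i \<subseteq> S" for S
  proof -
    have blocks: "block_ideal \<alpha> s t \<subseteq> S"
      if st: "\<alpha> \<in> {1, -1}" "1 \<le> t" "t \<le> s" "s \<le> CARD('p)" for \<alpha> s t
    proof (cases "s < CARD('p)")
      case True
      then have "P \<alpha> s t \<in> ?I" using st by auto
      from sub[OF this] show ?thesis
        by (simp only: summand_ideal.simps block_ideal_def True if_True)
    next
      case False
      have "X \<alpha> t \<in> ?I" using st by auto
      from sub[OF this] show ?thesis
        by (simp only: summand_ideal.simps block_ideal_def False if_False)
    qed
    have "(\<Sum>j\<in>J. K_proj (qroot CARD('p) powi int j)) \<in> S" if "finite J" for J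
      using that
    proof induction
      case (insert j J)
      then show ?case
        using S K_proj_in_left_ideal[OF card S blocks, of "int j"] by (simp add: left_ideal_def)
    qed (use S in \<open>simp add: left_ideal_def\<close>)
    then have "uq_scale (of_nat (2 * CARD('p))) 1 \<in> S"
      unfolding sum_K_proj[symmetric] by blast
    then have "uq_scalar (1 / of_nat (2 * CARD('p))) * uq_scale (of_nat (2 * CARD('p))) 1 \<in> S"
      using S by (simp add: left_ideal_def)
    then show ?thesis by (simp flip: uq_scale_def)
  qed
  fix i k assume i: "i \<in> ?I" and k: "k \<in> ?I" and ne: "k \<noteq> i"
  obtain \<alpha> s t where st: "\<alpha> \<in> {1, -1}" "1 \<le> t" "t \<le> s" "s \<le> CARD('p)"
    and Li: "?L i = block_ideal \<alpha> s t" and i_eq: "i = (if s < CARD('p) then P \<alpha> s t else X \<alpha> t)"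
    using params[OF i] by blast
  obtain \<beta> s' t' where st': "\<beta> \<in> {1, -1}" "1 \<le> t'" "t' \<le> s'" "s' \<le> CARD('p)"
    and Lk: "?L k = block_ideal \<beta> s' t'" and k_eq: "k = (if s' < CARD('p) then P \<beta> s' t' else X \<beta> t')"
    using params[OF k] by blast
  let ?w = "weight_param TYPE('p) \<alpha> s t" and ?w' = "weight_param TYPE('p) \<beta> s' t'"
  define z where "z = \<alpha> * qroot CARD('p) powi int s"
  define z' where "z' = \<beta> * qroot CARD('p) powi int s'"
  note eigen_i = block_ideal_eigen[OF card st, folded Li z_def]
  note eigen_k = block_ideal_eigen[OF card st', folded Lk z'_def]
  have scale: "uq_scale c x \<in> ?L j" if "j \<in> ?I" "x \<in> ?L j" for c j x
    using ideal[OF that(1)] that(2) by (simp add: left_ideal_def uq_scale_def)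
  have minus: "x - y \<in> ?L j" if "j \<in> ?I" "x \<in> ?L j" "y \<in> ?L j" for j x y
    using ideal[OF that(1)] that(2) scale[OF that(1,3), of "-1"] 
    by (metis (no_types, lifting) left_ideal_def uq.scale_minus_left uq.scale_one add_uminus_conv_diff)
  show "\<exists>T. (\<forall>x y. T (x + y) = T x + T y) \<and>
      (\<forall>j\<in>?I. \<forall>x\<in>?L j. T x \<in> ?L j) \<and> (\<forall>x\<in>?L k. T x = 0) \<and> (\<forall>x\<in>?L i. T x = 0 \<longrightarrow> x = 0)"
  proof (cases "?w = ?w'")
    case False
    \<comment> \<open>Right multiplication by K is a scalar on each summand, so it preserves these
      left ideals; this T is zero on \<open>?L k\<close> and the nonzero scalar
      \<open>?w - ?w'\<close> on \<open>?L i\<close>.\<close>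
    let ?T = "\<lambda>x :: 'p uqsl2. x * uqK - uq_scale ?w' x"
    have "?T x \<in> ?L j" if j: "j \<in> ?I" and x: "x \<in> ?L j" for j x
    proof -
      obtain \<gamma> a b where "\<gamma> \<in> {1, -1}" "1 \<le> b" "b \<le> a" "a \<le> CARD('p)" "?L j = block_ideal \<gamma> a b"
        using params[OF j] by blast
      then have "x * uqK = uq_scale (weight_param TYPE('p) \<gamma> a b) x"
        using block_ideal_eigen[OF card, of \<gamma> b a x] x by simp
      then show ?thesis using minus[OF j scale[OF j x] scale[OF j x]] by simp
    qed
    moreover have "?T x = 0" if "x \<in> ?L k" for x
      using eigen_k[OF that] by simp
    moreover have "x = 0" if "x \<in> ?L i" "?T x = 0" for x
    proof -
      have "uq_scale (?w - ?w') x = 0"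
        using eigen_i[OF that(1)] that(2) by (simp add: uq.scale_left_diff_distrib)
      then show ?thesis using False by simp
    qed
    moreover have "?T (x + y) = ?T x + ?T y" for x y
      by (simp add: distrib_right uq.scale_right_distrib)
    ultimately show ?thesis by (intro exI[of _ ?T] conjI allI ballI impI)
  next
    case True
    define d where "d = casimir_value CARD('p) z - casimir_value CARD('p) z'"
    have d: "d \<noteq> 0"
      using weight_casimir_value_inj[OF card st(1) st'(1) st(2-4) st'(2-4) True] ne
      by (auto simp: d_def z_def z'_def i_eq k_eq)
    let ?D = "casimir_shift z :: 'p uqsl2" and ?D' = "casimir_shift z' :: 'p uqsl2"
    \<comment> \<open>The shift is applied twice because \<open>block_ideal_eigen\<close> provides
      only D (D x) = 0.\<close>
    let ?T = "\<lambda>x :: 'p uqsl2. ?D' * (?D' * x)"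
    \<comment> \<open>If C - r' kills y, then C - r acts on y as -d, so its square kills y only for
      y = 0.\<close>
    have inj: "y = 0" if "?D' * y = 0" "?D * (?D * y) = 0" for y
    proof -
      have "?D * y = - uq_scale d y"
        using that(1) casimir_shift_change[of z' y z] by (simp add: d_def eq_neg_iff_add_eq_0)
      then have "?D * (?D * y) = uq_scale (d * d) y"
        by (simp add: casimir_shift_scale)
      then show ?thesis using that(2) d by simp
    qed
    have "x = 0" if x: "x \<in> ?L i" and T: "?T x = 0" for x
    proof -
      have DDx: "?D * (?D * x) = 0" using eigen_i[OF x] by simp
      have "?D * (?D * (?D' * x)) = ?D' * (?D * (?D * x))"
        by (simp only: casimir_shift_left_commute[OF card, of _ z'])
      then have "?D' * x = 0" using inj[of "?D' * x"] T DDx by simp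
      then show ?thesis using inj DDx by blast
    qed
    moreover have "?T x \<in> ?L j" if "j \<in> ?I" "x \<in> ?L j" for j x
      using ideal[OF that(1)] that(2) unfolding left_ideal_def by blast
    moreover have "?T x = 0" if "x \<in> ?L k" for x
      using eigen_k[OF that] by simp
    moreover have "?T (x + y) = ?T x + ?T y" for x y
      by (simp add: distrib_left)
    ultimately show ?thesis by (intro exI[of _ ?T] conjI allI ballI impI)
  qed
qed

end
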